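(* Let $\rho'$ be the composite \[ H^*(\mathrm{D}^r\mathrm{W}_{q+1}^+)\longrightarrow H^*(\mathrm{D}^r\mathrm{W}_q^+)\longrightarrow H^*(\mathrm{D}^r\mathrm{W}_q), \] where the first map is induced by $\widetilde\rho^{\,q+1}_q$ and the second is the natural homomorphism. Then the image of $\rho'$ consists of formally rigid elements, where $\gamma\in H^*(\mathrm{D}^r\mathrm{W}_q)$ is called formally rigid if $\delta\gamma=0$.
   Context: Let $q\ge1$ and let $r\in\mathbb{N}$ or $r=\infty$. Let $\widetilde{\mathrm{D}^r\mathrm{W}}_q=\bigwedge[h_{i,(a)}]\otimes\mathbb{R}[c_{i,(b)}]$ ($1\le i\le q$, $0\le a,b\le r$ integers), with $h_{i,(a)}$ of degree 1 and $c_{i,(b)}$ of degree 2, and with differential (signed derivation) $d$ given by $dh_{i,(a)}=c_{i,(a)}$, $dc_{i,(a)}=0$. Let $\widetilde\delta$ be the unsigned derivation on $\widetilde{\mathrm{D}^r\mathrm{W}}_q$ given by $\widetilde\delta(c_{i,(a)})=c_{i,(a+1)}$, $\widetilde\delta(h_{i,(a)})=h_{i,(a+1)}$, where $a<r$; it commutes with $d$. Write $c_i=c_{i,(0)}$. Define a weight, additive on monomials, by $\|c_{i,(l)}\|=\max\{i-l,0\}$, $\|h_{i,(0)}\|=0$, and $\|h_{i,(l)}\|=\max\{i-l,0\}$ for $l\ge1$. Set $\mathrm{D}^r\mathrm{W}_q=\widetilde{\mathrm{D}^r\mathrm{W}}_q/\mathscr{I}$, where $\mathscr{I}$ is the ideal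 generated by $\bigcup_{k\ge0}\widetilde\delta^k\mathscr{I}_0$ with $\mathscr{I}_0=\{c\in\widetilde{\mathrm{D}^r\mathrm{W}}_q : \|c\|>q\}$. The derivation $\widetilde\delta$ leaves $\mathscr{I}$ invariant, and the derivation it induces on $H^*(\mathrm{D}^r\mathrm{W}_q)$ is denoted by $\delta$. Set $\mathrm{D}^r\mathrm{W}_q^+=\widetilde{\mathrm{D}^r\mathrm{W}}_q/\mathcal{I}$, where $\mathcal{I}$ is the ideal generated by the monomials $c_1^{j_1}\cdots c_q^{j_q}$ with $j_1+2j_2+\cdots+qj_q>q$. Since $\mathcal{I}\subset\mathscr{I}$, there is a natural map $\mathrm{D}^r\mathrm{W}_q^+\to\mathrm{D}^r\mathrm{W}_q$. The homomorphism $\widetilde\rho^{\,q+1}_q\colon\widetilde{\mathrm{D}^r\mathrm{W}}_{q+1}\to\widetilde{\mathrm{D}^r\mathrm{W}}_q$ fixes $c_{i,(l)},h_{i,(l)}$ for $i\le q$ and sends $c_{q+1,(l)},h_{q+1,(l)}$ to $0$. *)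

theory Defs
  imports
    "HOL-Library.FSet"
    "HOL-Library.Multiset"
    "HOL-Library.Extended_Nat"
    "HOL-Library.Product_Lexorder"
    "HOL-Algebra.QuotRing"
begin

section \<open>Free graded commutative algebras\<close>

text \<open>
  \<open>'g fgca\<close> is the real algebra \<open>\<And>[h\<^sub>g] \<otimes> \<real>[c\<^sub>g]\<close> with one exterior generator \<open>h\<^sub>g\<close> and one
  polynomial generator \<open>c\<^sub>g\<close> for every \<open>g :: 'g\<close>. An element is given by its coefficients in the
  monomial basis: the pair \<open>(S, M)\<close> stands for
  \<open>h\<^bsub>s\<^sub>1\<^esub> \<and> \<dots> \<and> h\<^bsub>s\<^sub>k\<^esub> \<otimes> c\<^bsub>m\<^sub>1\<^esub> \<dots> c\<^bsub>m\<^sub>l\<^esub>\<close>, where \<open>S = {s\<^sub>1 < \<dots> < s\<^sub>k}\<close> and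
  \<open>M\<close> is the multiset of the \<open>m\<^sub>j\<close>. The linear order on \<open>'g\<close> only serves to fix the signs of the
  basis elements.
\<close>

type_synonym 'g mono = "'g fset \<times> 'g multiset"

typedef 'g fgca = "{f :: 'g mono \<Rightarrow> real. finite {m. f m \<noteq> 0}}"
  morphisms coef Abs_fgca
  by (rule exI[of _ "\<lambda>_. 0"]) simp

setup_lifting type_definition_fgca

instantiation fgca :: (type) real_vector
begin

lift_definition zero_fgca :: "'a fgca" is "\<lambda>_. 0" by simp

lift_definition plus_fgca :: "'a fgca \<Rightarrow> 'a fgca \<Rightarrow> 'a fgca" is "\<lambda>f g m. f m + g m"
proof -
  fix f g :: "'a mono \<Rightarrow> real"
  assume "finite {m. f m \<noteq> 0}" and "finite {m. g m \<noteq> 0}"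
  then have "finite ({m. f m \<noteq> 0} \<union> {m. g m \<noteq> 0})" by simp
  then show "finite {m. f m + g m \<noteq> 0}" by (rule finite_subset[rotated]) auto
qed

lift_definition uminus_fgca :: "'a fgca \<Rightarrow> 'a fgca" is "\<lambda>f m. - f m" by simp

definition minus_fgca :: "'a fgca \<Rightarrow> 'a fgca \<Rightarrow> 'a fgca" where
  "minus_fgca x y = x + - y"

lift_definition scaleR_fgca :: "real \<Rightarrow> 'a fgca \<Rightarrow> 'a fgca" is "\<lambda>a f m. a * f m"
  by (erule finite_subset[rotated]) auto

instance
proof
  fix x y z :: "'a fgca" and a b :: real
  show "x + y + z = x + (y + z)" by transfer (simp add: add.assoc)
  show "x + y = y + x" by transfer (simp add: add.commute)
  show "0 + x = x" by transfer simp
  show "- x + x = 0" by transfer simp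
  show "x - y = x + - y" by (simp add: minus_fgca_def)
  show "a *\<^sub>R (x + y) = a *\<^sub>R x + a *\<^sub>R y" by transfer (simp add: distrib_left)
  show "(a + b) *\<^sub>R x = a *\<^sub>R x + b *\<^sub>R x" by transfer (simp add: distrib_right)
  show "a *\<^sub>R b *\<^sub>R x = (a * b) *\<^sub>R x" by transfer (simp add: mult.assoc)
  show "1 *\<^sub>R x = x" by transfer simp
qed

end

definition supp :: "'g fgca \<Rightarrow> 'g mono set" where
  "supp x = {m. coef x m \<noteq> 0}"

lift_definition bas :: "'g mono \<Rightarrow> 'g fgca" is "\<lambda>m m'. if m' = m then 1 else 0" by simp

text \<open>The linear extension of a function on the monomial basis.\<close>

definition lin_ext :: "('g mono \<Rightarrow> 'b::real_vector) \<Rightarrow> 'g fgca \<Rightarrow> 'b" where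
  "lin_ext f x = (\<Sum>m\<in>supp x. coef x m *\<^sub>R f m)"

lemma finite_supp [simp]: "finite (supp x)"
  using coef[of x] by (simp add: supp_def)

lemma coef_zero [simp]: "coef 0 m = 0"
  and coef_add [simp]: "coef (x + y) m = coef x m + coef y m"
  and coef_scaleR [simp]: "coef (a *\<^sub>R x) m = a * coef x m"
  and coef_uminus [simp]: "coef (- x) m = - coef x m"
  and coef_bas: "coef (bas n) m = (if m = n then 1 else 0)"
  by (transfer; simp)+

lemma supp_bas [simp]: "supp (bas m) = {m}"
  by (auto simp: supp_def coef_bas)

lemma supp_zero [simp]: "supp 0 = {}"
  by (simp add: supp_def)

lemma supp_add: "supp (x + y) \<subseteq> supp x \<union> supp y"
  by (auto simp: supp_def)

lemma supp_scaleR: "supp (a *\<^sub>R x) \<subseteq> supp x"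
  by (auto simp: supp_def)

lemma supp_uminus [simp]: "supp (- x) = supp x"
  by (auto simp: supp_def)

lemma supp_sum: "supp (sum f A) \<subseteq> (\<Union>a\<in>A. supp (f a))"
proof (induction A rule: infinite_finite_induct)
  case (insert a A)
  then show ?case using supp_add[of "f a" "sum f A"] by auto
qed auto

lemma lin_ext_superset:
  assumes "finite A" "supp x \<subseteq> A"
  shows "lin_ext f x = (\<Sum>m\<in>A. coef x m *\<^sub>R f m)"
  unfolding lin_ext_def using assms by (intro sum.mono_neutral_left) (auto simp: supp_def)

lemma linear_lin_ext: "linear (lin_ext f)"
proof (rule linearI)
  fix x y :: "'a fgca" and a :: real
  have A: "finite (supp x \<union> supp y)" by simp
  show "lin_ext f (x + y) = lin_ext f x + lin_ext f y"
    using lin_ext_superset[OF A supp_add, where f = f] lin_ext_superset[OF A Un_upper1, where f = f]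
      lin_ext_superset[OF A Un_upper2, where f = f]
    by (simp add: scaleR_left_distrib sum.distrib)
  have "lin_ext f (a *\<^sub>R x) = (\<Sum>m\<in>supp x. coef (a *\<^sub>R x) m *\<^sub>R f m)"
    by (rule lin_ext_superset[OF finite_supp supp_scaleR])
  then show "lin_ext f (a *\<^sub>R x) = a *\<^sub>R lin_ext f x"
    by (simp add: lin_ext_def[of f x] scaleR_sum_right)
qed

lemma lin_ext_bas [simp]: "lin_ext f (bas m) = f m"
  by (simp add: lin_ext_def coef_bas)

lemmas lin_ext_simps [simp] =
  linear_add[OF linear_lin_ext] linear_0[OF linear_lin_ext]
  linear_scale[OF linear_lin_ext] linear_neg[OF linear_lin_ext]
  linear_diff[OF linear_lin_ext] linear_sum[OF linear_lin_ext]

lemma fgca_expand: "x = (\<Sum>m\<in>supp x. coef x m *\<^sub>R bas m)"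
proof -
  have "coef (\<Sum>m\<in>A. c m *\<^sub>R bas m) n = (if n \<in> A then c n else 0)"
    if "finite A" for A n and c :: "'a mono \<Rightarrow> real"
    using that by (induction A) (auto simp: coef_bas)
  from this[OF finite_supp]
  have "coef (\<Sum>m\<in>supp x. coef x m *\<^sub>R bas m) = coef x"
    by (auto simp: supp_def)
  then show ?thesis by (simp add: coef_inject)
qed

lemma fgca_induct [case_names zero bas add scale]:
  assumes "P 0" "\<And>m. P (bas m)" "\<And>x y. P x \<Longrightarrow> P y \<Longrightarrow> P (x + y)"
    "\<And>a x. P x \<Longrightarrow> P (a *\<^sub>R x)"
  shows "P x"
proof -
  have "P (\<Sum>m\<in>A. coef x m *\<^sub>R bas m)" if "finite A" for A
    using that by (induction A) (auto intro: assms)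
  then show ?thesis using fgca_expand[of x] by (metis finite_supp)
qed

text \<open>
  Product of basis elements: reordering the factors of \<open>h\<^sub>S \<and> h\<^sub>T\<close> increasingly takes as many
  transpositions as there are inversions between \<open>S\<close> and \<open>T\<close>.
\<close>

definition inversions :: "'g::linorder fset \<Rightarrow> 'g fset \<Rightarrow> nat" where
  "inversions S T = card {(s, t). s |\<in>| S \<and> t |\<in>| T \<and> t < s}"

definition mono_mult :: "'g::linorder mono \<Rightarrow> 'g mono \<Rightarrow> 'g fgca" where
  "mono_mult = (\<lambda>(S, M) (T, N).
     if S |\<inter>| T = {||} then (- 1) ^ inversions S T *\<^sub>R bas (S |\<union>| T, M + N) else 0)"

lemma finite_inversions: "finite {(s, t). s |\<in>| S \<and> t |\<in>| T \<and> t < s}"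
  by (rule finite_subset[of _ "fset S \<times> fset T"]) auto

lemma inversions_union_left:
  assumes "S |\<inter>| T = {||}"
  shows "inversions (S |\<union>| T) U = inversions S U + inversions T U"
proof -
  have "{(s, t). s |\<in>| S |\<union>| T \<and> t |\<in>| U \<and> t < s} =
    {(s, t). s |\<in>| S \<and> t |\<in>| U \<and> t < s} \<union> {(s, t). s |\<in>| T \<and> t |\<in>| U \<and> t < s}"
    by auto
  moreover have
    "{(s, t). s |\<in>| S \<and> t |\<in>| U \<and> t < s} \<inter> {(s, t). s |\<in>| T \<and> t |\<in>| U \<and> t < s} = {}"
    using assms by (auto simp: fset_eq_iff)
  ultimately show ?thesis
    unfolding inversions_def by (simp add: card_Un_disjoint finite_inversions)
qed

lemma inversions_union_right:
  assumes "T |\<inter>| U = {||}"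
  shows "inversions S (T |\<union>| U) = inversions S T + inversions S U"
proof -
  have "{(s, t). s |\<in>| S \<and> t |\<in>| T |\<union>| U \<and> t < s} =
    {(s, t). s |\<in>| S \<and> t |\<in>| T \<and> t < s} \<union> {(s, t). s |\<in>| S \<and> t |\<in>| U \<and> t < s}"
    by auto
  moreover have
    "{(s, t). s |\<in>| S \<and> t |\<in>| T \<and> t < s} \<inter> {(s, t). s |\<in>| S \<and> t |\<in>| U \<and> t < s} = {}"
    using assms by (auto simp: fset_eq_iff)
  ultimately show ?thesis
    unfolding inversions_def by (simp add: card_Un_disjoint finite_inversions)
qed

lemma inversions_empty [simp]: "inversions {||} T = 0" "inversions S {||} = 0"
  by (simp_all add: inversions_def)

instantiation fgca :: (linorder) real_algebra_1
begin

definition one_fgca :: "'a fgca" where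
  "one_fgca = bas ({||}, {#})"

definition times_fgca :: "'a fgca \<Rightarrow> 'a fgca \<Rightarrow> 'a fgca" where
  "times_fgca x y = lin_ext (\<lambda>m. lin_ext (mono_mult m) y) x"

instance
proof
  fix x y z :: "'a fgca" and a :: real
  have add_l: "(x + y) * z = x * z + y * z" and scale_l: "a *\<^sub>R x * y = a *\<^sub>R (x * y)"
    for x y z :: "'a fgca" and a :: real
    by (simp_all add: times_fgca_def)
  have add_r: "x * (y + z) = x * y + x * z" and scale_r: "x * a *\<^sub>R y = a *\<^sub>R (x * y)"
    for x y z :: "'a fgca" and a :: real
    by (simp_all add: times_fgca_def)
      (simp_all add: lin_ext_def[of _ x] scaleR_right_distrib sum.distrib scaleR_sum_right
        mult.commute)
  have zero: "0 * x = 0" "x * 0 = 0" for x :: "'a fgca"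
    using scale_l[of 0 x x] scale_r[of x 0 x] by simp_all
  have bas: "bas m * bas n = mono_mult m n" for m n :: "'a mono"
    by (simp add: times_fgca_def)
  show "(x + y) * z = x * z + y * z" "x * (y + z) = x * y + x * z"
    "a *\<^sub>R x * y = a *\<^sub>R (x * y)" "x * a *\<^sub>R y = a *\<^sub>R (x * y)"
    by (fact add_l add_r scale_l scale_r)+
  show "1 * x = x"
    by (induction x rule: fgca_induct)
      (auto simp: add_r scale_r zero one_fgca_def bas mono_mult_def)
  show "x * 1 = x"
    by (induction x rule: fgca_induct)
      (auto simp: add_l scale_l zero one_fgca_def bas mono_mult_def)
  show "(0::'a fgca) \<noteq> 1"
  proof
    assume "(0::'a fgca) = 1"
    then have "coef (0::'a fgca) ({||}, {#}) = coef 1 ({||}, {#})" by simp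
    then show False by (simp add: one_fgca_def coef_bas)
  qed
  have "bas m * bas n * bas p = bas m * (bas n * bas p)" for m n p :: "'a mono"
  proof -
    obtain S M T N U L where mnp: "m = (S, M)" "n = (T, N)" "p = (U, L)"
      by (metis surj_pair)
    show ?thesis
    proof (cases "S |\<inter>| T = {||} \<and> S |\<inter>| U = {||} \<and> T |\<inter>| U = {||}")
      case True
      then have "(S |\<union>| T) |\<inter>| U = {||}" "S |\<inter>| (T |\<union>| U) = {||}" by auto
      with True show ?thesis
        by (simp add: mnp bas mono_mult_def scale_l scale_r inversions_union_left
          inversions_union_right power_add algebra_simps sup_assoc)
    next
      case False
      have "(bas m * bas n) * bas p = 0"
        using False by (simp add: mnp bas mono_mult_def scale_l zero) (auto simp: inf_sup_distrib2)
      moreover have "bas m * (bas n * bas p) = 0"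
        using False by (simp add: mnp bas mono_mult_def scale_r zero) (auto simp: inf_sup_distrib1)
      ultimately show ?thesis by simp
    qed
  qed
  then have "bas m * bas n * z = bas m * (bas n * z)" for m n
    by (induction z rule: fgca_induct) (auto simp: add_r scale_r zero)
  then have "bas m * y * z = bas m * (y * z)" for m
    by (induction y rule: fgca_induct) (auto simp: add_l add_r scale_l scale_r zero)
  then show "x * y * z = x * (y * z)"
    by (induction x rule: fgca_induct) (auto simp: add_l scale_l zero)
qed

end

lemma bas_mult_bas: "bas m * bas n = mono_mult m n"
  by (simp add: times_fgca_def)

definition hgen :: "'g \<Rightarrow> 'g fgca" where
  "hgen g = bas ({|g|}, {#})"

definition cgen :: "'g \<Rightarrow> 'g fgca" where
  "cgen g = bas ({||}, {#g#})"

text \<open>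
  The linear operator \<open>\<Sum>\<^sub>g \<phi>(g) \<partial>/\<partial>h\<^sub>g + \<psi>(g) \<partial>/\<partial>c\<^sub>g\<close>, where \<open>\<partial>/\<partial>h\<^sub>g\<close> is the odd derivation
  with \<open>h\<^sub>g \<mapsto> 1\<close>. If \<open>\<phi>\<close> has even and \<open>\<psi>\<close> odd values, it is the signed derivation with
  \<open>h\<^sub>g \<mapsto> \<phi>(g)\<close> and \<open>c\<^sub>g \<mapsto> \<psi>(g)\<close>; if \<open>\<phi>\<close> has odd and \<open>\<psi>\<close> even values, it is the unsigned one.
\<close>

definition deriv_gen ::
  "('g::linorder \<Rightarrow> 'g fgca) \<Rightarrow> ('g \<Rightarrow> 'g fgca) \<Rightarrow> 'g fgca \<Rightarrow> 'g fgca" where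
  "deriv_gen \<phi> \<psi> = lin_ext (\<lambda>(S, M).
     (\<Sum>g\<in>fset S. \<phi> g * ((- 1) ^ card {s. s |\<in>| S \<and> s < g} *\<^sub>R bas (S |-| {|g|}, M)))
     + (\<Sum>g\<in>#M. \<psi> g * bas (S, M - {#g#})))"

text \<open>The automorphism \<open>x \<mapsto> (-1)\<^bsup>deg x\<^esup> x\<close> (\<open>h\<close> has degree 1, \<open>c\<close> has degree 2).\<close>

definition grade_inv :: "'g fgca \<Rightarrow> 'g fgca" where
  "grade_inv = lin_ext (\<lambda>(S, M). (- 1) ^ fcard S *\<^sub>R bas (S, M))"

lemma mult_supp:
  assumes "(U, L) \<in> supp (x * y)"
  shows "\<exists>S M T N. (S, M) \<in> supp x \<and> (T, N) \<in> supp y \<and> U = S |\<union>| T \<and> L = M + N"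
proof -
  have "(U, L) \<in> supp (\<Sum>m\<in>supp x. coef x m *\<^sub>R (\<Sum>n\<in>supp y. coef y n *\<^sub>R mono_mult m n))"
    using assms by (simp add: times_fgca_def lin_ext_def)
  then obtain m where m: "m \<in> supp x"
      "(U, L) \<in> supp (\<Sum>n\<in>supp y. coef y n *\<^sub>R mono_mult m n)"
    using supp_sum supp_scaleR by blast
  then obtain n where "n \<in> supp y" "(U, L) \<in> supp (mono_mult m n)"
    using supp_sum supp_scaleR by blast
  with m show ?thesis
    by (cases m; cases n) (fastforce simp: mono_mult_def supp_def coef_bas split: if_splits)
qed

abbreviation below :: "'g::linorder \<Rightarrow> 'g fset \<Rightarrow> nat" where
  "below g S \<equiv> card {s. s |\<in>| S \<and> s < g}"

definition dh :: "'g::linorder \<Rightarrow> 'g fgca \<Rightarrow> 'g fgca" where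
  "dh g = lin_ext (\<lambda>(S, M). if g |\<in>| S then (- 1) ^ below g S *\<^sub>R bas (S |-| {|g|}, M) else 0)"

definition dc :: "'g::linorder \<Rightarrow> 'g fgca \<Rightarrow> 'g fgca" where
  "dc g = lin_ext (\<lambda>(S, M). count M g *\<^sub>R bas (S, M - {#g#}))"

lemma finite_below [simp]: "finite {s. s |\<in>| S \<and> P s}"
  by (rule finite_subset[of _ "fset S"]) auto

lemma inversions_single_right: "inversions S {|g|} = card {s. s |\<in>| S \<and> g < s}"
proof -
  have "{(s, t). s |\<in>| S \<and> t |\<in>| {|g|} \<and> t < s} = (\<lambda>s. (s, g)) ` {s. s |\<in>| S \<and> g < s}" by auto
  then show ?thesis by (simp add: inversions_def card_image inj_on_def)
qed

lemma inversions_single_left: "inversions {|g|} T = below g T"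
proof -
  have "{(s, t). s |\<in>| {|g|} \<and> t |\<in>| T \<and> t < s} = (\<lambda>t. (g, t)) ` {t. t |\<in>| T \<and> t < g}" by auto
  then show ?thesis by (simp add: inversions_def card_image inj_on_def)
qed

lemma inversions_remove_left:
  assumes "g |\<in>| S" shows "inversions S T = inversions (S |-| {|g|}) T + below g T"
proof -
  have "S = (S |-| {|g|}) |\<union>| {|g|}" using assms by auto
  then show ?thesis
    using inversions_union_left[of "S |-| {|g|}" "{|g|}" T] inversions_single_left[of g T] by auto
qed

lemma inversions_remove_right:
  assumes "g |\<in>| T"
  shows "inversions S T = inversions S (T |-| {|g|}) + card {s. s |\<in>| S \<and> g < s}"
proof -
  have "T = (T |-| {|g|}) |\<union>| {|g|}" using assms by auto
  then show ?thesis
    using inversions_union_right[of "T |-| {|g|}" "{|g|}" S] inversions_single_right[of S g] by auto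
qed

lemma fcard_split: "fcard S = below g S + card {s. s |\<in>| S \<and> g < s} + (if g |\<in>| S then 1 else 0)"
proof -
  have "fset S = ({s. s |\<in>| S \<and> s < g} \<union> {s. s |\<in>| S \<and> g < s}) \<union> (if g |\<in>| S then {g} else {})"
    by (auto simp: not_less order_le_less)
  then have "fcard S = card (({s. s |\<in>| S \<and> s < g} \<union> {s. s |\<in>| S \<and> g < s})
      \<union> (if g |\<in>| S then {g} else {}))"
    by (simp only: fcard.rep_eq)
  also have "\<dots> = card ({s. s |\<in>| S \<and> s < g} \<union> {s. s |\<in>| S \<and> g < s})
      + card (if g |\<in>| S then {g} else {})"
    by (rule card_Un_disjoint) auto
  also have "card ({s. s |\<in>| S \<and> s < g} \<union> {s. s |\<in>| S \<and> g < s})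
      = below g S + card {s. s |\<in>| S \<and> g < s}"
    by (rule card_Un_disjoint) auto
  finally show ?thesis by (simp split: if_splits)
qed

lemma below_union:
  assumes "S |\<inter>| T = {||}" shows "below g (S |\<union>| T) = below g S + below g T"
proof -
  have "{s. s |\<in>| S |\<union>| T \<and> s < g} = {s. s |\<in>| S \<and> s < g} \<union> {s. s |\<in>| T \<and> s < g}" by auto
  moreover have "{s. s |\<in>| S \<and> s < g} \<inter> {s. s |\<in>| T \<and> s < g} = {}"
    using assms by (auto simp: fset_eq_iff)
  ultimately show ?thesis by (simp add: card_Un_disjoint)
qed

lemma dh_bas_mult:
  "dh g (bas (S, M) * bas (T, N)) =
    dh g (bas (S, M)) * bas (T, N) + grade_inv (bas (S, M)) * dh g (bas (T, N))"
proof (cases "S |\<inter>| T = {||}")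
  case disj: True
  show ?thesis
  proof (cases "g |\<in>| S")
    case gS: True
    with disj have gT: "g |\<notin>| T" by auto
    have d: "(S |-| {|g|}) |\<inter>| T = {||}" using disj by auto
    have u: "S |\<union>| T |-| {|g|} = (S |-| {|g|}) |\<union>| T" using gT by auto
    show ?thesis
      using gS gT disj d inversions_remove_left[OF gS, of T] below_union[OF disj, of g]
      by (simp add: bas_mult_bas mono_mult_def dh_def grade_inv_def u power_add)
  next
    case gS: False
    show ?thesis
    proof (cases "g |\<in>| T")
      case gT: True
      have d: "S |\<inter>| (T |-| {|g|}) = {||}" using disj by auto
      have u: "S |\<union>| T |-| {|g|} = S |\<union>| (T |-| {|g|})" using gS by auto
      show ?thesis
        using gS gT disj d inversions_remove_right[OF gT, of S] below_union[OF disj, of g]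
          fcard_split[of S g]
        by (simp add: bas_mult_bas mono_mult_def dh_def grade_inv_def u power_add mult_ac)
    next
      case gT: False
      with gS disj show ?thesis
        by (simp add: bas_mult_bas mono_mult_def dh_def grade_inv_def)
    qed
  qed
next
  case False
  then obtain k where k: "k |\<in>| S" "k |\<in>| T" by auto
  show ?thesis
  proof (cases "g |\<in>| S \<and> g |\<in>| T \<and> S |\<inter>| T = {|g|}")
    case True
    then have gS: "g |\<in>| S" and gT: "g |\<in>| T" and ST: "S |\<inter>| T = {|g|}" by auto
    have d: "(S |-| {|g|}) |\<inter>| T = {||}" "S |\<inter>| (T |-| {|g|}) = {||}"
      using ST by (auto simp: fset_eq_iff)
    have u: "(S |-| {|g|}) |\<union>| T = S |\<union>| T" "S |\<union>| (T |-| {|g|}) = S |\<union>| T"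
      using gS gT by auto
    have "below g S + inversions (S |-| {|g|}) T + below g T + 1 =
        fcard S + inversions S (T |-| {|g|})"
      using inversions_remove_left[OF gS, of T] inversions_remove_right[OF gT, of S]
        fcard_split[of S g] gS by simp
    then have "(- 1 :: real) ^ (below g S + inversions (S |-| {|g|}) T + below g T + 1) =
        (- 1) ^ (fcard S + inversions S (T |-| {|g|}))" by simp
    then have *: "(- 1 :: real) ^ below g S * (- 1) ^ inversions (S |-| {|g|}) T =
        - ((- 1) ^ fcard S * (- 1) ^ below g T * (- 1) ^ inversions S (T |-| {|g|}))"
      by (cases "even (below g T)") (auto simp: power_add)
    show ?thesis
      using gS gT d False *
      by (simp add: bas_mult_bas mono_mult_def dh_def grade_inv_def u power_add)
  next
    case F: False
    have "g |\<in>| S \<Longrightarrow> (S |-| {|g|}) |\<inter>| T \<noteq> {||}"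
      using F False by (auto simp: fset_eq_iff)
    moreover have "g |\<in>| T \<Longrightarrow> S |\<inter>| (T |-| {|g|}) \<noteq> {||}"
      using F False by (auto simp: fset_eq_iff)
    ultimately show ?thesis using False
      by (auto simp: bas_mult_bas mono_mult_def dh_def grade_inv_def)
  qed
qed

lemma dc_bas_mult:
  "dc g (bas (S, M) * bas (T, N)) = dc g (bas (S, M)) * bas (T, N) + bas (S, M) * dc g (bas (T, N))"
proof -
  have "count M g = 0 \<or> M + N - {#g#} = M - {#g#} + N"
    "count N g = 0 \<or> M + N - {#g#} = M + (N - {#g#})"
    by (auto simp: multiset_eq_iff)
  then show ?thesis
    by (auto simp: bas_mult_bas mono_mult_def dc_def scaleR_left_distrib scaleR_add_left algebra_simps)
qed

lemma sum_mset_count: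
  fixes f :: "'a \<Rightarrow> 'b::real_vector"
  assumes "finite G" "set_mset M \<subseteq> G"
  shows "(\<Sum>g\<in>#M. f g) = (\<Sum>g\<in>G. real (count M g) *\<^sub>R f g)"
  using assms(2)
proof (induction M)
  case (add x M)
  have "(\<Sum>g\<in>G. real (count (add_mset x M) g) *\<^sub>R f g) =
      (\<Sum>g\<in>G. (if g = x then f g else 0) + real (count M g) *\<^sub>R f g)"
    by (intro sum.cong) (auto simp: scaleR_left_distrib)
  also have "\<dots> = f x + (\<Sum>g\<in>G. real (count M g) *\<^sub>R f g)"
    using add.prems assms(1) by (simp add: sum.distrib)
  finally show ?case using add by simp
qed simp

lemma deriv_gen_bas:
  assumes "finite G" "fset S \<union> set_mset M \<subseteq> G"
  shows "deriv_gen \<phi> \<psi> (bas (S, M)) = (\<Sum>g\<in>G. \<phi> g * dh g (bas (S, M)) + \<psi> g * dc g (bas (S, M)))"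
proof -
  have "(\<Sum>g\<in>fset S. \<phi> g * ((- 1) ^ below g S *\<^sub>R bas (S |-| {|g|}, M))) =
      (\<Sum>g\<in>G. \<phi> g * dh g (bas (S, M)))"
    using assms by (intro sum.mono_neutral_cong_left) (auto simp: dh_def)
  moreover have "(\<Sum>g\<in>#M. \<psi> g * bas (S, M - {#g#})) = (\<Sum>g\<in>G. \<psi> g * dc g (bas (S, M)))"
    using sum_mset_count[OF assms(1), of M "\<lambda>g. \<psi> g * bas (S, M - {#g#})"] assms(2)
    by (simp add: dc_def)
  ultimately show ?thesis by (simp add: deriv_gen_def sum.distrib)
qed

lemma deriv_gen_eq:
  assumes "finite G" "\<And>S M. (S, M) \<in> supp x \<Longrightarrow> fset S \<union> set_mset M \<subseteq> G"
  shows "deriv_gen \<phi> \<psi> x = (\<Sum>g\<in>G. \<phi> g * dh g x + \<psi> g * dc g x)"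
proof -
  let ?E = "\<lambda>x. \<Sum>g\<in>G. \<phi> g * dh g x + \<psi> g * dc g x"
  have lin: "?E (\<Sum>m\<in>A. a m *\<^sub>R bas m) = (\<Sum>m\<in>A. a m *\<^sub>R ?E (bas m))" if "finite A" for A a
    using that
  proof (induction A)
    case (insert m A)
    have "?E (a m *\<^sub>R bas m + y) = a m *\<^sub>R ?E (bas m) + ?E y" for y
      by (simp add: dh_def dc_def algebra_simps sum.distrib scaleR_sum_right)
    with insert show ?case by simp
  qed (simp add: dh_def dc_def)
  have "deriv_gen \<phi> \<psi> x = (\<Sum>m\<in>supp x. coef x m *\<^sub>R deriv_gen \<phi> \<psi> (bas m))"
    by (simp add: deriv_gen_def lin_ext_def[of _ x])
  also have "\<dots> = (\<Sum>m\<in>supp x. coef x m *\<^sub>R ?E (bas m))"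
  proof (intro sum.cong refl)
    fix m assume m: "m \<in> supp x"
    obtain S M where SM: "m = (S, M)" by (cases m)
    from deriv_gen_bas[OF assms(1) assms(2)[OF m[unfolded SM]]]
    show "coef x m *\<^sub>R deriv_gen \<phi> \<psi> (bas m) = coef x m *\<^sub>R ?E (bas m)"
      by (simp only: SM)
  qed
  also have "\<dots> = ?E x"
    using lin[OF finite_supp, of "coef x" x] arg_cong[OF fgca_expand[of x], of ?E] by (simp only:)
  finally show ?thesis .
qed

lemma fgca_mult_induct [case_names add_l scale_l add_r scale_r bas]:
  fixes x y :: "'g::linorder fgca"
  assumes "\<And>x x' y. P x y \<Longrightarrow> P x' y \<Longrightarrow> P (x + x') y" "\<And>a x y. P x y \<Longrightarrow> P (a *\<^sub>R x) y"
    "\<And>x y y'. P x y \<Longrightarrow> P x y' \<Longrightarrow> P x (y + y')" "\<And>a x y. P x y \<Longrightarrow> P x (a *\<^sub>R y)"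
    "\<And>m n. P (bas m) (bas n)"
  shows "P x y"
proof -
  have *: "P (bas m) y" for m
  proof (induction y rule: fgca_induct)
    case zero
    then show ?case using assms(4)[of "bas m" "bas m" 0] assms(5) by simp
  qed (auto intro: assms)
  show ?thesis
  proof (induction x rule: fgca_induct)
    case zero
    then show ?case using assms(2)[OF *, of 0] by simp
  qed (auto intro: assms *)
qed

lemma dh_mult: "dh g (x * y) = dh g x * y + grade_inv x * dh g y"
proof (induction x y rule: fgca_mult_induct)
  case (bas m n)
  then show ?case by (metis dh_bas_mult surj_pair)
qed (auto simp: dh_def grade_inv_def algebra_simps)

lemma dc_mult: "dc g (x * y) = dc g x * y + x * dc g y"
proof (induction x y rule: fgca_mult_induct)
  case (bas m n)
  then show ?case by (metis dc_bas_mult surj_pair)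
qed (auto simp: dc_def algebra_simps)

lemma ex_finite_gens: "\<exists>G. finite G \<and> (\<forall>(S, M)\<in>supp x \<union> supp y \<union> supp z. fset S \<union> set_mset M \<subseteq> G)"
  by (rule exI[of _ "\<Union>(S, M)\<in>supp x \<union> supp y \<union> supp z. fset S \<union> set_mset M"]) auto

lemma cgen_central: "cgen g * x = x * cgen g"
proof (induction x rule: fgca_induct)
  case (bas m)
  then show ?case by (cases m) (simp add: cgen_def bas_mult_bas mono_mult_def)
qed (auto simp: algebra_simps)

lemma hgen_odd: "hgen g * x = grade_inv x * hgen g"
proof (induction x rule: fgca_induct)
  case (bas m)
  obtain S M where m: "m = (S, M)" by fastforce
  have "g |\<notin>| S \<Longrightarrow> fcard S = below g S + card {s. s |\<in>| S \<and> g < s}"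
    using fcard_split[of S g] by simp
  then show ?case
    by (auto simp: m hgen_def bas_mult_bas mono_mult_def grade_inv_def power_add
      inversions_single_left inversions_single_right)
qed (auto simp: grade_inv_def algebra_simps)

lemma grade_inv_inv [simp]: "grade_inv (grade_inv x) = x"
  by (induction x rule: fgca_induct) (auto simp: grade_inv_def)

lemma deriv_gen_signed:
  assumes "\<And>g x. \<phi> g * x = x * \<phi> g"
  shows "deriv_gen \<phi> (\<lambda>_. 0) (x * y) =
    deriv_gen \<phi> (\<lambda>_. 0) x * y + grade_inv x * deriv_gen \<phi> (\<lambda>_. 0) y"
proof -
  obtain G where G: "finite G"
      "\<And>S M. (S, M) \<in> supp x \<union> supp y \<union> supp (x * y) \<Longrightarrow> fset S \<union> set_mset M \<subseteq> G"
    using ex_finite_gens[of x y "x * y"] by fast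
  have eq: "deriv_gen \<phi> (\<lambda>_. 0) z = (\<Sum>g\<in>G. \<phi> g * dh g z)" if "z \<in> {x, y, x * y}" for z
    using that G(2) by (subst deriv_gen_eq[OF G(1)]) auto
  have "\<phi> g * dh g (x * y) = \<phi> g * dh g x * y + grade_inv x * (\<phi> g * dh g y)" for g
    using assms[of g "grade_inv x"] by (simp add: dh_mult distrib_left flip: mult.assoc)
  then show ?thesis
    by (simp add: eq sum.distrib sum_distrib_left sum_distrib_right)
qed

lemma deriv_gen_unsigned:
  assumes "\<And>g x. \<phi> g * x = grade_inv x * \<phi> g" "\<And>g x. \<psi> g * x = x * \<psi> g"
  shows "deriv_gen \<phi> \<psi> (x * y) = deriv_gen \<phi> \<psi> x * y + x * deriv_gen \<phi> \<psi> y"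
proof -
  obtain G where G: "finite G"
      "\<And>S M. (S, M) \<in> supp x \<union> supp y \<union> supp (x * y) \<Longrightarrow> fset S \<union> set_mset M \<subseteq> G"
    using ex_finite_gens[of x y "x * y"] by fast
  have eq: "deriv_gen \<phi> \<psi> z = (\<Sum>g\<in>G. \<phi> g * dh g z) + (\<Sum>g\<in>G. \<psi> g * dc g z)"
    if "z \<in> {x, y, x * y}" for z
    using that G(2) by (subst deriv_gen_eq[OF G(1)]) (auto simp: sum.distrib)
  have 1: "\<phi> g * dh g (x * y) = \<phi> g * dh g x * y + x * (\<phi> g * dh g y)" for g
    using assms(1)[of g "grade_inv x"] by (simp add: dh_mult distrib_left flip: mult.assoc)
  have 2: "\<psi> g * dc g (x * y) = \<psi> g * dc g x * y + x * (\<psi> g * dc g y)" for g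
    using assms(2)[of g x] by (simp add: dc_mult distrib_left flip: mult.assoc)
  show ?thesis
    by (simp add: eq 1 2 sum.distrib sum_distrib_left sum_distrib_right distrib_left distrib_right)
qed


section \<open>The algebras of the theory\<close>

text \<open>
  The generators are indexed by pairs \<open>(i, a)\<close>, i.e. \<open>h\<^bsub>i,(a)\<^esub> = hgen (i, a)\<close> and
  \<open>c\<^bsub>i,(a)\<^esub> = cgen (i, a)\<close>. The parameter \<open>r :: enat\<close> is a natural number or \<open>\<infinity>\<close>.
\<close>

type_synonym idx = "nat \<times> nat"

definition gens :: "enat \<Rightarrow> nat \<Rightarrow> idx set" where
  "gens r q = {(i, a). 1 \<le> i \<and> i \<le> q \<and> enat a \<le> r}"

definition DWt :: "enat \<Rightarrow> nat \<Rightarrow> idx fgca ring" where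
  "DWt r q =
     \<lparr>carrier = {x. \<forall>(S, M)\<in>supp x. fset S \<subseteq> gens r q \<and> set_mset M \<subseteq> gens r q},
      mult = (*), one = 1, zero = 0, add = (+)\<rparr>"

lemma DWt_carrier: "x \<in> carrier (DWt r q) \<longleftrightarrow>
    (\<forall>m\<in>supp x. fset (fst m) \<subseteq> gens r q \<and> set_mset (snd m) \<subseteq> gens r q)"
  by (simp add: DWt_def split_beta)

lemma DWt_ring: "ring (DWt r q)"
proof (rule ringI)
  have add: "x + y \<in> carrier (DWt r q)" if "x \<in> carrier (DWt r q)" "y \<in> carrier (DWt r q)" for x y
    using that supp_add[of x y] unfolding DWt_carrier by blast
  have mul: "x * y \<in> carrier (DWt r q)" if "x \<in> carrier (DWt r q)" "y \<in> carrier (DWt r q)" for x y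
    unfolding DWt_carrier
  proof
    fix m assume "m \<in> supp (x * y)"
    moreover obtain U L where "m = (U, L)" by (cases m)
    ultimately obtain S M T N where
      *: "(S, M) \<in> supp x" "(T, N) \<in> supp y" "m = (S |\<union>| T, M + N)"
      using mult_supp by metis
    with that show "fset (fst m) \<subseteq> gens r q \<and> set_mset (snd m) \<subseteq> gens r q"
      unfolding DWt_carrier by fastforce
  qed
  have neg: "- x \<in> carrier (DWt r q)" if "x \<in> carrier (DWt r q)" for x
    using that by (simp add: DWt_carrier)
  have z: "0 \<in> carrier (DWt r q)" "1 \<in> carrier (DWt r q)"
    by (auto simp: DWt_carrier one_fgca_def)
  show "abelian_group (DWt r q)"
  proof (rule abelian_groupI)
    fix x assume "x \<in> carrier (DWt r q)"
    then show "\<exists>y\<in>carrier (DWt r q). y \<oplus>\<^bsub>DWt r q\<^esub> x = \<zero>\<^bsub>DWt r q\<^esub>"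
      using neg[of x] by (intro bexI[of _ "-x"]) (simp_all add: DWt_def)
  next
    fix x y assume "x \<in> carrier (DWt r q)" "y \<in> carrier (DWt r q)"
    then show "x \<oplus>\<^bsub>DWt r q\<^esub> y \<in> carrier (DWt r q)" using add[of x y] by (simp add: DWt_def)
  next
    show "\<zero>\<^bsub>DWt r q\<^esub> \<in> carrier (DWt r q)" using z by (simp add: DWt_def)
  qed (simp_all add: DWt_def add_ac)
  show "Group.monoid (DWt r q)"
  proof (rule monoidI)
    fix x y assume "x \<in> carrier (DWt r q)" "y \<in> carrier (DWt r q)"
    then show "x \<otimes>\<^bsub>DWt r q\<^esub> y \<in> carrier (DWt r q)" using mul[of x y] by (simp add: DWt_def)
  next
    show "\<one>\<^bsub>DWt r q\<^esub> \<in> carrier (DWt r q)" using z by (simp add: DWt_def)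
  qed (simp_all add: DWt_def mult.assoc)
qed (simp_all add: DWt_def distrib_left distrib_right)

definition dd :: "idx fgca \<Rightarrow> idx fgca" where
  "dd = deriv_gen cgen (\<lambda>_. 0)"

lemma below_self [simp]: "{s::'g::linorder. s = g \<and> s < g} = {}"
  by auto

lemma dd_generators: "dd (hgen g) = cgen g" "dd (cgen g) = 0"
  by (simp_all add: dd_def deriv_gen_def hgen_def cgen_def bas_mult_bas mono_mult_def)

lemma dd_signed_derivation: "linear dd" "dd (x * y) = dd x * y + grade_inv x * dd y"
  by (simp_all add: dd_def deriv_gen_signed cgen_central) (simp add: deriv_gen_def linear_lin_ext)

text \<open>For finite \<open>r\<close> the generators of top level \<open>r\<close> are sent to \<open>0\<close>.\<close>

definition delta :: "enat \<Rightarrow> idx fgca \<Rightarrow> idx fgca" where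
  "delta r = deriv_gen
     (\<lambda>(i, a). if enat a < r then hgen (i, Suc a) else 0)
     (\<lambda>(i, a). if enat a < r then cgen (i, Suc a) else 0)"

lemma delta_generators:
  "delta r (hgen (i, a)) = (if enat a < r then hgen (i, Suc a) else 0)"
  "delta r (cgen (i, a)) = (if enat a < r then cgen (i, Suc a) else 0)"
  by (simp_all add: delta_def deriv_gen_def hgen_def cgen_def bas_mult_bas mono_mult_def)

lemma delta_derivation: "linear (delta r)" "delta r (x * y) = delta r x * y + x * delta r y"
proof -
  show "linear (delta r)" by (simp add: delta_def deriv_gen_def linear_lin_ext)
  show "delta r (x * y) = delta r x * y + x * delta r y"
    unfolding delta_def by (rule deriv_gen_unsigned) (auto simp: hgen_odd cgen_central)
qed

definition rho :: "nat \<Rightarrow> idx fgca \<Rightarrow> idx fgca" where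
  "rho q = lin_ext (\<lambda>(S, M).
     if \<forall>(i, a) \<in> fset S \<union> set_mset M. i \<le> q then bas (S, M) else 0)"

lemma rho_generators:
  "rho q (hgen (i, a)) = (if i \<le> q then hgen (i, a) else 0)"
  "rho q (cgen (i, a)) = (if i \<le> q then cgen (i, a) else 0)"
  by (simp_all add: rho_def hgen_def cgen_def)

lemma rho_hom: "linear (rho q)" "rho q 1 = 1" "rho q (x * y) = rho q x * rho q y"
proof -
  show "linear (rho q)" "rho q 1 = 1" by (simp_all add: rho_def linear_lin_ext one_fgca_def)
  show "rho q (x * y) = rho q x * rho q y"
  proof (induction x y rule: fgca_mult_induct)
    case (bas m n)
    then show ?case
      by (cases m; cases n) (auto simp: rho_def bas_mult_bas mono_mult_def)
  qed (auto simp: rho_def algebra_simps)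
qed

text \<open>On \<open>nat\<close>, the difference \<open>i - l\<close> is \<open>max {i - l, 0}\<close>.\<close>

definition weight :: "idx mono \<Rightarrow> nat" where
  "weight = (\<lambda>(S, M). (\<Sum>(i, l)\<in>fset S. if l = 0 then 0 else i - l) + (\<Sum>(i, l)\<in>#M. i - l))"

text \<open>\<open>\<parallel>x\<parallel> > q\<close> for a general element means that all its monomials have weight \<open>> q\<close>.\<close>

definition I0 :: "enat \<Rightarrow> nat \<Rightarrow> idx fgca set" where
  "I0 r q = {x \<in> carrier (DWt r q). \<forall>m\<in>supp x. weight m > q}"

definition I_DW :: "enat \<Rightarrow> nat \<Rightarrow> idx fgca set" where
  "I_DW r q = Idl\<^bsub>DWt r q\<^esub> (\<Union>k. (delta r ^^ k) ` I0 r q)"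

definition cpower :: "nat \<Rightarrow> (nat \<Rightarrow> nat) \<Rightarrow> idx fgca" where
  "cpower q j = prod_list (map (\<lambda>i. cgen (i, 0) ^ j i) [1..<Suc q])"

definition I_DWplus :: "enat \<Rightarrow> nat \<Rightarrow> idx fgca set" where
  "I_DWplus r q = Idl\<^bsub>DWt r q\<^esub> {cpower q j | j. (\<Sum>i=1..q. i * j i) > q}"

definition DW :: "enat \<Rightarrow> nat \<Rightarrow> idx fgca set ring" where
  "DW r q = DWt r q Quot I_DW r q"

definition DWplus :: "enat \<Rightarrow> nat \<Rightarrow> idx fgca set ring" where
  "DWplus r q = DWt r q Quot I_DWplus r q"

text \<open>
  The map \<open>I + x \<mapsto> J + f x\<close> from cosets of some \<open>I\<close> to cosets of \<open>J\<close> in \<open>S\<close>; \<^const>\<open>the_elem\<close>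
  picks the common value for all representatives \<open>x\<close>.
\<close>

definition quot_map :: "('b, 'm) ring_scheme \<Rightarrow> 'b set \<Rightarrow> ('a \<Rightarrow> 'b) \<Rightarrow> 'a set \<Rightarrow> 'b set" where
  "quot_map S J f X = the_elem ((\<lambda>x. J +>\<^bsub>S\<^esub> f x) ` X)"

text \<open>
  Cohomology is taken of the total complex: \<open>ker d / im d\<close> is the direct sum of the \<open>H\<^sup>k\<close>.
\<close>

definition cocycles :: "('a, 'm) ring_scheme \<Rightarrow> ('a \<Rightarrow> 'a) \<Rightarrow> 'a set" where
  "cocycles C d = {x \<in> carrier C. d x = \<zero>\<^bsub>C\<^esub>}"

definition coboundaries :: "('a, 'm) ring_scheme \<Rightarrow> ('a \<Rightarrow> 'a) \<Rightarrow> 'a set" where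
  "coboundaries C d = d ` carrier C"

definition cohomology :: "('a, 'm) ring_scheme \<Rightarrow> ('a \<Rightarrow> 'a) \<Rightarrow> 'a set ring" where
  "cohomology C d = (C\<lparr>carrier := cocycles C d\<rparr>) Quot (coboundaries C d)"

definition d_DW :: "enat \<Rightarrow> nat \<Rightarrow> idx fgca set \<Rightarrow> idx fgca set" where
  "d_DW r q = quot_map (DWt r q) (I_DW r q) dd"

definition d_DWplus :: "enat \<Rightarrow> nat \<Rightarrow> idx fgca set \<Rightarrow> idx fgca set" where
  "d_DWplus r q = quot_map (DWt r q) (I_DWplus r q) dd"

definition H_DW :: "enat \<Rightarrow> nat \<Rightarrow> idx fgca set set ring" where
  "H_DW r q = cohomology (DW r q) (d_DW r q)"

definition H_DWplus :: "enat \<Rightarrow> nat \<Rightarrow> idx fgca set set ring" where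
  "H_DWplus r q = cohomology (DWplus r q) (d_DWplus r q)"

definition delta_H :: "enat \<Rightarrow> nat \<Rightarrow> idx fgca set set \<Rightarrow> idx fgca set set" where
  "delta_H r q = quot_map (DW r q) (coboundaries (DW r q) (d_DW r q))
     (quot_map (DWt r q) (I_DW r q) (delta r))"

text \<open>\<open>H\<^sup>*(D\<^sup>rW\<^sup>+\<^bsub>q+1\<^esub>) \<rightarrow> H\<^sup>*(D\<^sup>rW\<^sup>+\<^sub>q)\<close>, induced by \<^const>\<open>rho\<close>\<close>

definition rho_H :: "enat \<Rightarrow> nat \<Rightarrow> idx fgca set set \<Rightarrow> idx fgca set set" where
  "rho_H r q = quot_map (DWplus r q) (coboundaries (DWplus r q) (d_DWplus r q))
     (quot_map (DWt r q) (I_DWplus r q) (rho q))"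

text \<open>\<open>H\<^sup>*(D\<^sup>rW\<^sup>+\<^sub>q) \<rightarrow> H\<^sup>*(D\<^sup>rW\<^sub>q)\<close>, induced by the projection \<open>D\<^sup>rW\<^sup>+\<^sub>q \<rightarrow> D\<^sup>rW\<^sub>q\<close>\<close>

definition nat_H :: "enat \<Rightarrow> nat \<Rightarrow> idx fgca set set \<Rightarrow> idx fgca set set" where
  "nat_H r q = quot_map (DW r q) (coboundaries (DW r q) (d_DW r q))
     (quot_map (DWt r q) (I_DW r q) (\<lambda>x. x))"

definition rho' :: "enat \<Rightarrow> nat \<Rightarrow> idx fgca set set \<Rightarrow> idx fgca set set" where
  "rho' r q = nat_H r q \<circ> rho_H r q"

definition formally_rigid :: "enat \<Rightarrow> nat \<Rightarrow> idx fgca set set \<Rightarrow> bool" where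
  "formally_rigid r q \<gamma> \<longleftrightarrow> \<gamma> \<in> carrier (H_DW r q) \<and> delta_H r q \<gamma> = \<zero>\<^bsub>H_DW r q\<^esub>"

end

theory Submission
  imports Defs
begin

text \<open>
  The derivation \<open>\<delta>\<close> is null-homotopic already on the free algebra: \<open>\<delta> = d \<kappa> + \<kappa> d\<close>, where \<open>\<kappa>\<close> is
  the signed derivation with \<open>c\<^bsub>i,(a)\<^esub> \<mapsto> h\<^bsub>i,(a+1)\<^esub>\<close> and \<open>h\<^bsub>i,(a)\<^esub> \<mapsto> 0\<close>, since both sides are
  derivations that agree on the generators. However, \<open>\<kappa>\<close> does not preserve the ideal of \<open>D\<^sup>rW\<^sub>q\<close>:
  replacing \<open>c\<^sub>i\<close> of weight \<open>i\<close> by \<open>h\<^bsub>i,(1)\<^esub>\<close> of weight \<open>i - 1\<close> loses one unit of weight. For a cocycle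
  \<open>x\<close> of \<open>D\<^sup>rW\<^sup>+\<^bsub>q+1\<^esub>\<close> that unit is available: \<open>d x\<close> lies in the ideal generated by the monomials
  \<open>c\<^sup>J\<close> of weight \<open>> q + 1\<close>, so \<open>\<kappa> (\<rho> (d x))\<close> lies in the ideal of \<open>D\<^sup>rW\<^sub>q\<close>, and
  \<open>\<delta> (\<rho> x) \<equiv> d (\<kappa> (\<rho> x))\<close> is a coboundary there.
\<close>

section \<open>Derivations of the free algebra\<close>

text \<open>Each basis monomial arises from 1, up to sign, by multiplying generators on the left;
  \<open>scale\<close> absorbs the sign from sorting the exterior factors. With the generator on the
  left, signed Leibniz rules evaluate \<open>grade_inv\<close> only at that generator.\<close>

lemma fgca_gen_induct [case_names one hgen cgen add scale]:
  fixes x :: "'g::linorder fgca"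
  assumes one: "P 1"
    and hgen: "\<And>g x. P x \<Longrightarrow> P (hgen g * x)"
    and cgen: "\<And>g x. P x \<Longrightarrow> P (cgen g * x)"
    and add: "\<And>x y. P x \<Longrightarrow> P y \<Longrightarrow> P (x + y)"
    and scale: "\<And>a x. P x \<Longrightarrow> P (a *\<^sub>R x)"
  shows "P x"
proof (induction x rule: fgca_induct)
  case zero
  show ?case using scale[OF one, of 0] by simp
next
  case (bas m)
  have ext: "P (bas (S, {#}))" for S
  proof (induction S)
    case empty
    show ?case using one by (simp add: one_fgca_def)
  next
    case (insert g S)
    then have "bas (finsert g S, {#}) = (- 1) ^ below g S *\<^sub>R (hgen g * bas (S, {#}))"
      by (simp add: hgen_def bas_mult_bas mono_mult_def inversions_single_left flip: power_add)
    then show ?case using insert hgen scale by simp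
  qed
  have "P (bas (S, M))" for S M
  proof (induction M)
    case empty
    show ?case by (rule ext)
  next
    case (add g M)
    have "bas (S, add_mset g M) = cgen g * bas (S, M)"
      by (simp add: cgen_def bas_mult_bas mono_mult_def)
    then show ?case using add cgen by simp
  qed
  then show ?case by (cases m) simp
qed (auto intro: add scale)

lemma linear_deriv_gen: "linear (deriv_gen \<phi> \<psi>)"
  by (simp add: deriv_gen_def linear_lin_ext)

lemma deriv_gen_one [simp]: "deriv_gen \<phi> \<psi> 1 = 0"
  by (simp add: deriv_gen_def one_fgca_def)

text \<open>Each \<open>dc g\<close> obeys the unsigned Leibniz rule, so the sign arises only from
  moving the odd coefficient \<open>\<psi> g\<close> past \<open>x\<close>. In
  \<open>deriv_gen_signed\<close> it comes from \<open>dh g\<close> instead.\<close>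

lemma deriv_gen_signed_odd:
  assumes "\<And>g x. \<psi> g * x = grade_inv x * \<psi> g"
  shows "deriv_gen (\<lambda>_. 0) \<psi> (x * y) =
    deriv_gen (\<lambda>_. 0) \<psi> x * y + grade_inv x * deriv_gen (\<lambda>_. 0) \<psi> y"
proof -
  obtain G where G: "finite G"
      "\<And>S M. (S, M) \<in> supp x \<union> supp y \<union> supp (x * y) \<Longrightarrow> fset S \<union> set_mset M \<subseteq> G"
    using ex_finite_gens[of x y "x * y"] by fast
  have eq: "deriv_gen (\<lambda>_. 0) \<psi> z = (\<Sum>g\<in>G. \<psi> g * dc g z)" if "z \<in> {x, y, x * y}" for z
    using that G(2) by (subst deriv_gen_eq[OF G(1)]) auto
  have "\<psi> g * dc g (x * y) = \<psi> g * dc g x * y + grade_inv x * (\<psi> g * dc g y)" for g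
    using assms[of g x] by (simp add: dc_mult distrib_left flip: mult.assoc)
  then show ?thesis
    by (simp add: eq sum.distrib sum_distrib_left sum_distrib_right)
qed

section \<open>The parity automorphism\<close>

lemma linear_grade_inv: "linear grade_inv"
  by (simp add: grade_inv_def linear_lin_ext)

lemma grade_inv_bas: "grade_inv (bas (S, M)) = (- 1) ^ fcard S *\<^sub>R bas (S, M)"
  by (simp add: grade_inv_def)

lemma grade_inv_mult: "grade_inv (x * y) = grade_inv x * grade_inv y"
proof (induction x y rule: fgca_mult_induct)
  case (bas m n)
  obtain S M T N where [simp]: "m = (S, M)" "n = (T, N)" by (metis surj_pair)
  show ?case
  proof (cases "S |\<inter>| T = {||}")
    case True
    then have "fcard (S |\<union>| T) = fcard S + fcard T"
      by (rule fcard_funion_disjoint)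
    with True show ?thesis
      by (simp add: grade_inv_def bas_mult_bas mono_mult_def power_add mult_ac)
  qed (simp add: grade_inv_def bas_mult_bas mono_mult_def)
qed (simp_all add: grade_inv_def algebra_simps)

lemma grade_inv_generators [simp]:
  "grade_inv 1 = 1" "grade_inv (hgen g) = - hgen g" "grade_inv (cgen g) = cgen g"
  by (simp_all add: grade_inv_def one_fgca_def hgen_def cgen_def fcard.rep_eq)

section \<open>The contracting homotopy for \<open>delta\<close>\<close>

definition kappa :: "enat \<Rightarrow> idx fgca \<Rightarrow> idx fgca" where
  "kappa r = deriv_gen (\<lambda>_. 0) (\<lambda>(i, a). if enat a < r then hgen (i, Suc a) else 0)"

lemma kappa_generators:
  "kappa r (hgen g) = 0"
  "kappa r (cgen (i, a)) = (if enat a < r then hgen (i, Suc a) else 0)"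
  by (simp_all add: kappa_def deriv_gen_def hgen_def cgen_def bas_mult_bas mono_mult_def)

lemma linear_kappa: "linear (kappa r)"
  by (simp add: kappa_def linear_deriv_gen)

lemma kappa_mult: "kappa r (x * y) = kappa r x * y + grade_inv x * kappa r y"
  unfolding kappa_def by (rule deriv_gen_signed_odd) (auto simp: hgen_odd)

lemma deriv_one [simp]: "dd 1 = 0" "delta r 1 = 0" "kappa r 1 = 0"
  by (simp_all add: dd_def delta_def kappa_def)

lemmas lin_simps =
  linear_add[OF dd_signed_derivation(1)] linear_0[OF dd_signed_derivation(1)]
  linear_scale[OF dd_signed_derivation(1)] linear_neg[OF dd_signed_derivation(1)]
  linear_diff[OF dd_signed_derivation(1)]
  linear_add[OF delta_derivation(1)] linear_0[OF delta_derivation(1)]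
  linear_scale[OF delta_derivation(1)] linear_neg[OF delta_derivation(1)]
  linear_diff[OF delta_derivation(1)]
  linear_add[OF linear_kappa] linear_0[OF linear_kappa]
  linear_scale[OF linear_kappa] linear_neg[OF linear_kappa]
  linear_diff[OF linear_kappa]
  linear_add[OF linear_grade_inv] linear_0[OF linear_grade_inv]
  linear_scale[OF linear_grade_inv] linear_neg[OF linear_grade_inv]
  linear_diff[OF linear_grade_inv]
  linear_add[OF rho_hom(1)] linear_0[OF rho_hom(1)] linear_scale[OF rho_hom(1)]
  linear_neg[OF rho_hom(1)] linear_diff[OF rho_hom(1)]

lemmas mult_simps = dd_signed_derivation(2) delta_derivation(2) kappa_mult grade_inv_mult rho_hom(3)

lemmas generator_simps = dd_generators delta_generators kappa_generators rho_generators

lemma dd_dd: "dd (dd x) = 0"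
  by (induction x rule: fgca_gen_induct) (simp_all add: lin_simps mult_simps dd_generators)

text \<open>The right side is the graded commutator of two odd derivations, so its cross terms
  cancel. On an h only \<open>kappa r (dd x)\<close> contributes, on a c only
  \<open>dd (kappa r x)\<close>. At the top level a = r of a finite r, both \<open>kappa\<close> and
  \<open>delta\<close> give 0, so the identity holds there too.\<close>

lemma delta_homotopy: "delta r x = dd (kappa r x) + kappa r (dd x)"
proof (induction x rule: fgca_gen_induct)
  case (hgen g x)
  then show ?case
    by (cases g) (simp add: lin_simps mult_simps generator_simps algebra_simps)
next
  case (cgen g x)
  then show ?case
    by (cases g) (simp add: lin_simps mult_simps generator_simps algebra_simps)
qed (simp_all add: lin_simps algebra_simps)

text \<open>By the homotopy formula and d^2 = 0, both sides equal d \<open>kappa\<close> d.\<close>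

lemma dd_delta: "dd (delta r x) = delta r (dd x)"
  by (simp add: delta_homotopy lin_simps dd_dd)

text \<open>\<open>delta\<close> turns an h into an h and a c into a c, so it preserves
  parity.\<close>

lemma grade_inv_delta: "grade_inv (delta r x) = delta r (grade_inv x)"
proof (induction x rule: fgca_gen_induct)
  case (hgen g x)
  then show ?case
    by (cases g) (simp add: lin_simps mult_simps generator_simps)
next
  case (cgen g x)
  then show ?case
    by (cases g) (simp add: lin_simps mult_simps generator_simps)
qed (simp_all add: lin_simps)

lemma rho_dd: "rho q (dd x) = dd (rho q x)"
proof (induction x rule: fgca_gen_induct)
  case (hgen g x)
  then show ?case
    by (cases g) (simp add: lin_simps mult_simps generator_simps)
next
  case (cgen g x)
  then show ?case
    by (cases g) (simp add: lin_simps mult_simps generator_simps)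
qed (simp_all add: lin_simps rho_hom(2))


section \<open>Stability of the carriers and of the weight filtration\<close>

lemma linear_in_subspace:
  assumes "linear f" "subspace V" "\<And>S M. (S, M) \<in> supp x \<Longrightarrow> f (bas (S, M)) \<in> V"
  shows "f x \<in> V"
proof -
  have "f x = (\<Sum>m\<in>supp x. coef x m *\<^sub>R f (bas m))"
    by (subst fgca_expand[of x]) (simp add: linear_sum[OF assms(1)] linear_scale[OF assms(1)])
  also have "\<dots> \<in> V"
    using assms(3) by (intro subspace_sum[OF assms(2)] subspace_scale[OF assms(2)]) auto
  finally show ?thesis .
qed

lemma DWt_simps [simp]:
  "mult (DWt r q) = (*)" "one (DWt r q) = 1" "zero (DWt r q) = 0" "add (DWt r q) = (+)"
  by (simp_all add: DWt_def)

lemma DWt_suppD: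
  "x \<in> carrier (DWt r q) \<Longrightarrow> (S, M) \<in> supp x \<Longrightarrow> fset S \<union> set_mset M \<subseteq> gens r q"
  by (fastforce simp: DWt_carrier)

lemma DWt_subspace: "subspace (carrier (DWt r q))"
proof (rule subspaceI)
  show "0 \<in> carrier (DWt r q)" by (simp add: DWt_carrier)
  show "x + y \<in> carrier (DWt r q)" if "x \<in> carrier (DWt r q)" "y \<in> carrier (DWt r q)" for x y
    using ring.ring_simprules(1)[OF DWt_ring that] by simp
  show "a *\<^sub>R x \<in> carrier (DWt r q)" if "x \<in> carrier (DWt r q)" for a x
    using that supp_scaleR[of a x] by (auto simp: DWt_carrier)
qed

lemma DWt_mult: "x \<in> carrier (DWt r q) \<Longrightarrow> y \<in> carrier (DWt r q) \<Longrightarrow> x * y \<in> carrier (DWt r q)"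
  using ring.ring_simprules(5)[OF DWt_ring, of x r q y] by simp

lemma bas_DWt: "bas (S, M) \<in> carrier (DWt r q) \<longleftrightarrow> fset S \<union> set_mset M \<subseteq> gens r q"
  by (simp add: DWt_carrier)

lemma subspace_sum_mset:
  assumes "subspace V" "\<And>g. g \<in># M \<Longrightarrow> f g \<in> V"
  shows "(\<Sum>g\<in>#M. f g) \<in> V"
  using assms(2) by (induction M) (auto intro: subspace_add[OF assms(1)] subspace_0[OF assms(1)])

text \<open>Invariance under a derivation is thereby reduced to replacing a single factor of a
  single monomial; the signs and multiplicities are harmless in a subspace.\<close>

lemma deriv_gen_in_subspace:
  assumes "subspace V"
    and "\<And>S M g. (S, M) \<in> supp x \<Longrightarrow> g |\<in>| S \<Longrightarrow> \<phi> g * bas (S |-| {|g|}, M) \<in> V"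
    and "\<And>S M g. (S, M) \<in> supp x \<Longrightarrow> g \<in># M \<Longrightarrow> \<psi> g * bas (S, M - {#g#}) \<in> V"
  shows "deriv_gen \<phi> \<psi> x \<in> V"
proof (rule linear_in_subspace[OF linear_deriv_gen assms(1)])
  fix S M assume "(S, M) \<in> supp x"
  with assms(2,3) show "deriv_gen \<phi> \<psi> (bas (S, M)) \<in> V"
    unfolding deriv_gen_def lin_ext_bas prod.case
    by (intro subspace_add[OF assms(1)] subspace_sum[OF assms(1)] subspace_sum_mset[OF assms(1)])
      (auto intro: subspace_scale[OF assms(1)])
qed

lemma deriv_gen_DWt:
  assumes "x \<in> carrier (DWt r q)"
    and "\<And>g. g \<in> gens r q \<Longrightarrow> \<phi> g \<in> carrier (DWt r q)"
    and "\<And>g. g \<in> gens r q \<Longrightarrow> \<psi> g \<in> carrier (DWt r q)"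
  shows "deriv_gen \<phi> \<psi> x \<in> carrier (DWt r q)"
proof (rule deriv_gen_in_subspace[OF DWt_subspace])
  fix S M g assume "(S, M) \<in> supp x"
  then have SM: "fset S \<union> set_mset M \<subseteq> gens r q" by (rule DWt_suppD[OF assms(1)])
  show "\<phi> g * bas (S |-| {|g|}, M) \<in> carrier (DWt r q)" if "g |\<in>| S"
    using SM that by (intro DWt_mult assms(2)) (auto simp: bas_DWt)
  show "\<psi> g * bas (S, M - {#g#}) \<in> carrier (DWt r q)" if "g \<in># M"
    using SM that by (intro DWt_mult assms(3)) (auto simp: bas_DWt dest: in_diffD)
qed

lemma generators_DWt:
  "hgen g \<in> carrier (DWt r q) \<longleftrightarrow> g \<in> gens r q" "cgen g \<in> carrier (DWt r q) \<longleftrightarrow> g \<in> gens r q"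
  by (simp_all add: hgen_def cgen_def bas_DWt)

lemma gens_Suc: "(i, a) \<in> gens r q \<Longrightarrow> enat a < r \<Longrightarrow> (i, Suc a) \<in> gens r q"
  by (auto simp: gens_def ileI1 simp flip: eSuc_enat)

lemma zero_DWt: "0 \<in> carrier (DWt r q)"
  by (rule subspace_0[OF DWt_subspace])

lemma dd_DWt: "x \<in> carrier (DWt r q) \<Longrightarrow> dd x \<in> carrier (DWt r q)"
  unfolding dd_def by (rule deriv_gen_DWt) (auto simp: generators_DWt zero_DWt)

lemma delta_DWt: "x \<in> carrier (DWt r q) \<Longrightarrow> delta r x \<in> carrier (DWt r q)"
  unfolding delta_def
  by (rule deriv_gen_DWt) (auto simp: generators_DWt zero_DWt gens_Suc)

lemma kappa_DWt: "x \<in> carrier (DWt r q) \<Longrightarrow> kappa r x \<in> carrier (DWt r q)"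
  unfolding kappa_def
  by (rule deriv_gen_DWt) (auto simp: generators_DWt zero_DWt gens_Suc)

text \<open>One inclusion suffices: \<open>grade_inv\<close> is an involution, so applying it to
  \<open>x\<close> and to \<open>grade_inv x\<close> gives both.\<close>

lemma supp_grade_inv: "supp (grade_inv x) = supp x"
proof -
  have *: "supp (grade_inv x) \<subseteq> supp x" for x :: "'a fgca"
  proof -
    have "subspace {y. supp y \<subseteq> supp x}"
      using supp_add supp_scaleR by (intro subspaceI) (auto, blast+)
    then have "grade_inv x \<in> {y. supp y \<subseteq> supp x}"
      by (rule linear_in_subspace[OF linear_grade_inv])
        (auto simp: grade_inv_bas dest!: subsetD[OF supp_scaleR])
    then show ?thesis by simp
  qed
  show ?thesis using *[of x] *[of "grade_inv x"] by simp
qed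

lemma grade_inv_DWt: "x \<in> carrier (DWt r q) \<Longrightarrow> grade_inv x \<in> carrier (DWt r q)"
  by (simp add: DWt_carrier supp_grade_inv)

lemma rho_DWt: "x \<in> carrier (DWt r (Suc q)) \<Longrightarrow> rho q x \<in> carrier (DWt r q)"
proof (rule linear_in_subspace[OF rho_hom(1) DWt_subspace])
  fix S M assume "x \<in> carrier (DWt r (Suc q))" "(S, M) \<in> supp x"
  then have "fset S \<union> set_mset M \<subseteq> gens r (Suc q)" by (rule DWt_suppD)
  then show "rho q (bas (S, M)) \<in> carrier (DWt r q)"
    by (fastforce simp: rho_def bas_DWt zero_DWt gens_def)
qed

lemma I0_subspace: "subspace (I0 r q)"
proof (rule subspaceI)
  show "0 \<in> I0 r q" by (simp add: I0_def zero_DWt)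
  show "x + y \<in> I0 r q" if "x \<in> I0 r q" "y \<in> I0 r q" for x y
    using that supp_add[of x y] subspace_add[OF DWt_subspace] unfolding I0_def by blast
  show "a *\<^sub>R x \<in> I0 r q" if "x \<in> I0 r q" for a x
    using that supp_scaleR[of a x] subspace_scale[OF DWt_subspace] unfolding I0_def by blast
qed

lemma bas_I0: "bas (S, M) \<in> I0 r q \<longleftrightarrow> fset S \<union> set_mset M \<subseteq> gens r q \<and> weight (S, M) > q"
  by (simp add: I0_def bas_DWt)

section \<open>Change of weight under replacement of a factor\<close>

lemma weight_remove_h:
  assumes "(i, l) |\<in>| S"
  shows "weight (S, M) = (if l = 0 then 0 else i - l) + weight (S |-| {|(i, l)|}, M)"
  using assms by (simp add: weight_def sum.remove[of "fset S" "(i, l)"])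

lemma weight_remove_c:
  assumes "(i, l) \<in># M"
  shows "weight (S, M) = (i - l) + weight (S, M - {#(i, l)#})"
  using assms by (auto simp: weight_def dest!: multi_member_split)

lemma weight_add_mset: "weight (S, add_mset (i, l) M) = (i - l) + weight (S, M)"
  by (simp add: weight_def)

lemma weight_finsert:
  "(i, l) |\<notin>| S \<Longrightarrow> weight (finsert (i, l) S, M) = (if l = 0 then 0 else i - l) + weight (S, M)"
  by (simp add: weight_def)

lemma grade_inv_I0: "x \<in> I0 r q \<Longrightarrow> grade_inv x \<in> I0 r q"
  by (simp add: I0_def supp_grade_inv grade_inv_DWt)

text \<open>Replacing h_{i,(l)} by c_{i,(l)} never lowers the weight: it is unchanged for l > 0 and
  grows by i for l = 0.\<close>

lemma dd_I0:
  assumes "x \<in> I0 r q"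
  shows "dd x \<in> I0 r q"
  unfolding dd_def
proof (rule deriv_gen_in_subspace[OF I0_subspace])
  fix S M g assume *: "(S, M) \<in> supp x" "g |\<in>| S"
  obtain i l where g: "g = (i, l)" by (cases g)
  have "fset S \<union> set_mset M \<subseteq> gens r q" "weight (S, M) > q"
    using assms * DWt_suppD[of x r q S M] by (auto simp: I0_def)
  then show "cgen g * bas (S |-| {|g|}, M) \<in> I0 r q"
    using *(2) weight_remove_h[of i l S M]
    by (auto simp: cgen_def bas_mult_bas mono_mult_def bas_I0 weight_add_mset g split: if_splits)
qed (simp add: subspace_0[OF I0_subspace])

text \<open>Here the surplus unit in the bound \<open>Suc q\<close> is spent: one factor of weight i
  becomes h_{i,(1)} of weight i - 1, so the weight stays above q.\<close>

lemma kappa_bas_I0: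
  assumes "set_mset M \<subseteq> gens r q" "\<And>i l. (i, l) \<in># M \<Longrightarrow> l = 0" "weight ({||}, M) > Suc q"
  shows "kappa r (bas ({||}, M)) \<in> I0 r q"
  unfolding kappa_def
proof (rule deriv_gen_in_subspace[OF I0_subspace])
  fix S N g assume "(S, N) \<in> supp (bas ({||}, M))" "g \<in># N"
  then have [simp]: "S = {||}" "N = M" and g: "g \<in># M" by auto
  obtain i where i: "g = (i, 0)" using assms(2) g by (cases g) auto
  \<comment> \<open>For r = 0 there is no level 1; the replaced factor is then 0, which lies in
    every subspace.\<close>
  have "(i, Suc 0) \<in> gens r q" if "0 < r"
    using assms(1) g gens_Suc[of i 0 r q] that by (auto simp: i zero_enat_def)
  moreover have "i - 1 + weight ({||}, M - {#(i, 0)#}) > q"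
    using weight_remove_c[of i 0 M "{||}"] g assms(3) by (simp add: i)
  moreover have "set_mset (M - {#(i, 0)#}) \<subseteq> gens r q"
    using assms(1) by (auto dest: in_diffD)
  ultimately show "(case g of (i, a) \<Rightarrow> if enat a < r then hgen (i, Suc a) else 0) * bas (S, N - {#g#})
      \<in> I0 r q"
    by (simp add: i hgen_def bas_mult_bas mono_mult_def bas_I0 weight_finsert
        subspace_0[OF I0_subspace] flip: zero_enat_def)
qed (simp add: subspace_0[OF I0_subspace])


section \<open>Invariance of the ideals\<close>

lemma DWt_a_inv: "x \<in> carrier (DWt r q) \<Longrightarrow> \<ominus>\<^bsub>DWt r q\<^esub> x = - x"
  using subspace_neg[OF DWt_subspace]
  by (intro abelian_group.minus_equality[OF ring.is_abelian_group[OF DWt_ring]]) auto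

text \<open>The condition on \<open>\<sigma> x\<close> is what makes the set closed under right
  multiplication, since D (x a) contains the term \<open>\<sigma>\<close> x * D a. Taking
  \<open>\<sigma>\<close> to be the identity or \<open>grade_inv\<close> covers unsigned and signed
  derivations at once.\<close>

lemma ideal_stable_part:
  assumes "ideal I (DWt r q)" "linear \<sigma>" "linear D"
    and \<sigma>_closed: "\<And>x. x \<in> carrier (DWt r q) \<Longrightarrow> \<sigma> x \<in> carrier (DWt r q)"
    and D_closed: "\<And>x. x \<in> carrier (DWt r q) \<Longrightarrow> D x \<in> carrier (DWt r q)"
    and \<sigma>_mult: "\<And>x y. \<sigma> (x * y) = \<sigma> x * \<sigma> y"
    and D_mult: "\<And>x y. D (x * y) = D x * y + \<sigma> x * D y"
  shows "ideal {x \<in> I. \<sigma> x \<in> I \<and> D x \<in> I} (DWt r q)"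
proof -
  interpret I: ideal I "DWt r q" by fact
  note lin = linear_add[OF assms(2)] linear_add[OF assms(3)] linear_neg[OF assms(2)]
    linear_neg[OF assms(3)] linear_0[OF assms(2)] linear_0[OF assms(3)]
  have add: "x + y \<in> I" if "x \<in> I" "y \<in> I" for x y
    using additive_subgroup.a_closed[OF ideal.axioms(1)[OF assms(1)] that] by simp
  have mult: "a * x \<in> I" "x * a \<in> I" if "x \<in> I" "a \<in> carrier (DWt r q)" for a x
    using I.I_l_closed[of x a] I.I_r_closed[of x a] that by simp_all
  have neg: "- x \<in> I" if "x \<in> I" for x
    using additive_subgroup.a_inv_closed[OF ideal.axioms(1)[OF assms(1)] that] DWt_a_inv[OF I.a_Hcarr[OF that]] by simp
  have zero: "0 \<in> I"
    using additive_subgroup.zero_closed[OF ideal.axioms(1)[OF assms(1)]] by simp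
  show ?thesis
  proof (rule idealI[OF DWt_ring])
    show "subgroup {x \<in> I. \<sigma> x \<in> I \<and> D x \<in> I} (add_monoid (DWt r q))"
    proof (rule I.add.subgroupI)
      show "{x \<in> I. \<sigma> x \<in> I \<and> D x \<in> I} \<noteq> {}"
        using zero lin by force
    next
      fix x assume "x \<in> {x \<in> I. \<sigma> x \<in> I \<and> D x \<in> I}"
      then show "\<ominus>\<^bsub>DWt r q\<^esub> x \<in> {x \<in> I. \<sigma> x \<in> I \<and> D x \<in> I}"
        using neg by (auto simp: DWt_a_inv lin)
    qed (use add in \<open>auto simp: lin\<close>)
  qed (use add mult \<sigma>_closed D_closed in \<open>auto simp: \<sigma>_mult D_mult\<close>)
qed

text \<open>The part of the generated ideal that stays inside it under \<open>\<sigma>\<close> and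
  \<open>D\<close> is an ideal containing the generators, hence everything by minimality.\<close>

lemma genideal_stable:
  assumes "G \<subseteq> carrier (DWt r q)" "linear \<sigma>" "linear D"
    and "\<And>x. x \<in> carrier (DWt r q) \<Longrightarrow> \<sigma> x \<in> carrier (DWt r q)"
    and "\<And>x. x \<in> carrier (DWt r q) \<Longrightarrow> D x \<in> carrier (DWt r q)"
    and "\<And>x y. \<sigma> (x * y) = \<sigma> x * \<sigma> y"
    and "\<And>x y. D (x * y) = D x * y + \<sigma> x * D y"
    and gen: "\<And>g. g \<in> G \<Longrightarrow> \<sigma> g \<in> Idl\<^bsub>DWt r q\<^esub> G" "\<And>g. g \<in> G \<Longrightarrow> D g \<in> Idl\<^bsub>DWt r q\<^esub> G"
    and x: "x \<in> Idl\<^bsub>DWt r q\<^esub> G"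
  shows "D x \<in> Idl\<^bsub>DWt r q\<^esub> G"
proof -
  have "Idl\<^bsub>DWt r q\<^esub> G \<subseteq> {x \<in> Idl\<^bsub>DWt r q\<^esub> G. \<sigma> x \<in> Idl\<^bsub>DWt r q\<^esub> G \<and> D x \<in> Idl\<^bsub>DWt r q\<^esub> G}"
    using gen ring.genideal_self[OF DWt_ring assms(1)]
    by (intro ring.genideal_minimal[OF DWt_ring] ideal_stable_part
        ring.genideal_ideal[OF DWt_ring] assms(1-7)) auto
  then show ?thesis using x by blast
qed

section \<open>The ideal of \<open>DW\<close> and its derivations\<close>

lemma delta_funpow_DWt: "x \<in> carrier (DWt r q) \<Longrightarrow> (delta r ^^ k) x \<in> carrier (DWt r q)"
  by (induction k) (auto simp: delta_DWt)

lemma I_DW_generators: "(\<Union>k. (delta r ^^ k) ` I0 r q) \<subseteq> carrier (DWt r q)"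
  by (auto simp: I0_def delta_funpow_DWt)

lemma I_DW_ideal: "ideal (I_DW r q) (DWt r q)"
  unfolding I_DW_def by (rule ring.genideal_ideal[OF DWt_ring I_DW_generators])

lemma delta_funpow_I0: "x \<in> I0 r q \<Longrightarrow> (delta r ^^ k) x \<in> I_DW r q"
  unfolding I_DW_def using ring.genideal_self[OF DWt_ring I_DW_generators] by blast

lemma I0_I_DW: "x \<in> I0 r q \<Longrightarrow> x \<in> I_DW r q"
  using delta_funpow_I0[of x r q 0] by simp

lemma delta_I_DW: "x \<in> I_DW r q \<Longrightarrow> delta r x \<in> I_DW r q"
  unfolding I_DW_def
proof (rule genideal_stable[OF I_DW_generators, where \<sigma> = "\<lambda>x. x" and D = "delta r"])
  fix g assume "g \<in> (\<Union>k. (delta r ^^ k) ` I0 r q)"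
  then obtain k x where "x \<in> I0 r q" "g = (delta r ^^ k) x" by blast
  then show "g \<in> Idl\<^bsub>DWt r q\<^esub> (\<Union>k. (delta r ^^ k) ` I0 r q)"
    and "delta r g \<in> Idl\<^bsub>DWt r q\<^esub> (\<Union>k. (delta r ^^ k) ` I0 r q)"
    using delta_funpow_I0[of x r q k] delta_funpow_I0[of x r q "Suc k"] by (simp_all add: I_DW_def)
qed (simp_all add: delta_derivation delta_DWt linear_ident)

text \<open>Both \<open>grade_inv\<close> and \<open>dd\<close> commute with the powers of
  \<open>delta\<close> and preserve \<open>I0\<close>, so they map generators to generators.\<close>

lemma dd_I_DW: "x \<in> I_DW r q \<Longrightarrow> dd x \<in> I_DW r q"
  unfolding I_DW_def
proof (rule genideal_stable[OF I_DW_generators, where \<sigma> = grade_inv and D = dd])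
  fix g assume "g \<in> (\<Union>k. (delta r ^^ k) ` I0 r q)"
  then obtain k x where x: "x \<in> I0 r q" "g = (delta r ^^ k) x" by blast
  have "grade_inv ((delta r ^^ k) x) = (delta r ^^ k) (grade_inv x)"
    by (induction k) (simp_all add: grade_inv_delta)
  moreover have "dd ((delta r ^^ k) x) = (delta r ^^ k) (dd x)"
    by (induction k) (simp_all add: dd_delta)
  ultimately show "grade_inv g \<in> Idl\<^bsub>DWt r q\<^esub> (\<Union>k. (delta r ^^ k) ` I0 r q)"
    and "dd g \<in> Idl\<^bsub>DWt r q\<^esub> (\<Union>k. (delta r ^^ k) ` I0 r q)"
    using x delta_funpow_I0[OF grade_inv_I0, of x r q k] delta_funpow_I0[OF dd_I0, of x r q k]
    by (simp_all add: I_DW_def)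
qed (simp_all add: dd_signed_derivation dd_DWt grade_inv_DWt grade_inv_mult linear_grade_inv)

section \<open>The monomials c^J and the ideal of \<open>DWplus\<close>\<close>

definition cmset :: "nat \<Rightarrow> (nat \<Rightarrow> nat) \<Rightarrow> idx multiset" where
  "cmset q j = (\<Sum>i\<leftarrow>[1..<Suc q]. replicate_mset (j i) (i, 0))"

text \<open>A product of c's carries no sign, so it is a single basis element, whose weight and
  support can be read off directly.\<close>

lemma cpower_bas: "cpower q j = bas ({||}, cmset q j)"
proof -
  have mult: "bas ({||}, M) * bas ({||}, N) = bas ({||}, M + N)" for M N :: "idx multiset"
    by (simp add: bas_mult_bas mono_mult_def)
  have pow: "cgen (i, 0 :: nat) ^ n = bas ({||}, replicate_mset n (i, 0))" for i n :: nat
    by (induction n) (simp_all add: one_fgca_def cgen_def bas_mult_bas mono_mult_def)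
  have "prod_list (map (\<lambda>i. cgen (i, 0 :: nat) ^ j i) xs) =
      bas ({||}, \<Sum>i\<leftarrow>xs. replicate_mset (j i) (i, 0))" for xs
    by (induction xs) (simp_all add: pow mult one_fgca_def)
  then show ?thesis by (simp add: cpower_def cmset_def)
qed

lemma cpower_Suc: "cpower (Suc q) j = cpower q j * cgen (Suc q, 0) ^ j (Suc q)"
  by (simp add: cpower_def)

lemma cmset_Suc: "cmset (Suc q) j = cmset q j + replicate_mset (j (Suc q)) (Suc q, 0)"
  by (simp add: cmset_def)

lemma set_cmset: "(i, l) \<in># cmset q j \<Longrightarrow> 1 \<le> i \<and> i \<le> q \<and> l = 0"
  by (induction q) (auto simp: cmset_Suc cmset_def[of 0] split: if_splits)

lemma weight_cmset: "weight ({||}, cmset q j) = (\<Sum>i=1..q. i * j i)"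
proof (induction q)
  case (Suc q)
  have "weight ({||}, M + replicate_mset n (i, 0)) = weight ({||}, M) + i * n" for M n i
    by (induction n) (simp_all add: weight_add_mset)
  with Suc show ?case by (simp add: cmset_Suc)
qed (simp add: cmset_def weight_def)

lemma cmset_gens: "set_mset (cmset q j) \<subseteq> gens r q"
  using set_cmset[of _ _ q j] by (fastforce simp: gens_def simp flip: zero_enat_def)

lemma I_DWplus_generators: "{cpower q j | j. (\<Sum>i=1..q. i * j i) > q} \<subseteq> carrier (DWt r q)"
  using cmset_gens by (auto simp: cpower_bas bas_DWt)

lemma I_DWplus_ideal: "ideal (I_DWplus r q) (DWt r q)"
  unfolding I_DWplus_def by (rule ring.genideal_ideal[OF DWt_ring I_DWplus_generators])

lemma cpower_I0: "(\<Sum>i=1..q. i * j i) > q \<Longrightarrow> cpower q j \<in> I0 r q"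
  by (simp add: cpower_bas bas_I0 weight_cmset cmset_gens)

lemma cpower_I_DWplus: "(\<Sum>i=1..q. i * j i) > q \<Longrightarrow> cpower q j \<in> I_DWplus r q"
  unfolding I_DWplus_def using ring.genideal_self[OF DWt_ring I_DWplus_generators] by blast

text \<open>The generating monomials already have weight above q, so they lie in \<open>I0\<close>.
  This makes the natural map well defined.\<close>

lemma I_DWplus_subset: "I_DWplus r q \<subseteq> I_DW r q"
  unfolding I_DWplus_def
  by (rule ring.genideal_minimal[OF DWt_ring I_DW_ideal]) (auto simp del: One_nat_def intro: I0_I_DW cpower_I0)

lemma grade_inv_cpower: "grade_inv (cpower q j) = cpower q j"
  by (simp add: cpower_bas grade_inv_bas fcard.rep_eq)

lemma dd_cpower: "dd (cpower q j) = 0"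
  by (simp add: cpower_bas dd_def deriv_gen_def)

lemma dd_I_DWplus: "x \<in> I_DWplus r q \<Longrightarrow> dd x \<in> I_DWplus r q"
  unfolding I_DWplus_def
proof (rule genideal_stable[OF I_DWplus_generators, where \<sigma> = grade_inv and D = dd])
  fix g assume "g \<in> {cpower q j | j. (\<Sum>i=1..q. i * j i) > q}"
  then obtain j where j: "g = cpower q j" "(\<Sum>i=1..q. i * j i) > q" by blast
  then show "grade_inv g \<in> Idl\<^bsub>DWt r q\<^esub> {cpower q j | j. (\<Sum>i=1..q. i * j i) > q}"
    using cpower_I_DWplus by (simp add: grade_inv_cpower I_DWplus_def)
  show "dd g \<in> Idl\<^bsub>DWt r q\<^esub> {cpower q j | j. (\<Sum>i=1..q. i * j i) > q}"
    using additive_subgroup.zero_closed[OF ideal.axioms(1)[OF I_DWplus_ideal], of r q]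
    by (simp add: j dd_cpower I_DWplus_def)
qed (simp_all add: dd_signed_derivation dd_DWt grade_inv_DWt grade_inv_mult linear_grade_inv)

section \<open>Restriction from q + 1 to q\<close>

lemma rho_ring_hom: "ring_hom_ring (DWt r (Suc q)) (DWt r q) (rho q)"
  by (intro ring_hom_ringI2 ring_hom_memI DWt_ring) (use rho_DWt in \<open>auto simp: rho_hom lin_simps\<close>)

lemma rho_cpower: "rho q (cpower (Suc q) j) = (if j (Suc q) = 0 then cpower q j else 0)"
proof -
  have "rho q (cpower q j) = cpower q j"
    using set_cmset[of _ _ q j] by (auto simp: cpower_bas rho_def)
  moreover have "rho q (cgen (Suc q, 0) ^ n) = (if n = 0 then 1 else 0)" for n
    by (induction n) (simp_all add: rho_hom rho_generators)
  ultimately show ?thesis by (simp add: cpower_Suc rho_hom)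
qed

text \<open>The preimage of \<open>J\<close> under \<open>rho q\<close> is an ideal, so generators
  suffice. The assumption \<open>gen\<close> keeps the bound \<open>Suc q\<close> rather than q,
  recording that surviving monomials have one more unit of weight than the ideal at q
  demands.\<close>

lemma rho_I_DWplus_ideal:
  assumes J: "ideal J (DWt r q)"
    and gen: "\<And>j. (\<Sum>i=1..q. i * j i) > Suc q \<Longrightarrow> cpower q j \<in> J"
    and x: "x \<in> I_DWplus r (Suc q)"
  shows "rho q x \<in> J"
proof -
  \<comment> \<open>A monomial containing c_{q+1} is sent to 0; otherwise the last summand of the
    weight vanishes and the sum up to q has the same value.\<close>
  have "rho q (cpower (Suc q) j) \<in> J" if "(\<Sum>i=1..Suc q. i * j i) > Suc q" for j
    using that gen[of j] additive_subgroup.zero_closed[OF ideal.axioms(1)[OF J]]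
    by (cases "j (Suc q) = 0") (simp_all add: rho_cpower)
  then have "I_DWplus r (Suc q) \<subseteq> {x \<in> carrier (DWt r (Suc q)). rho q x \<in> J}"
    unfolding I_DWplus_def using I_DWplus_generators[of "Suc q" r]
    by (intro ring.genideal_minimal[OF DWt_ring] ring_hom_ring.ideal_vimage[OF rho_ring_hom J]) auto
  then show ?thesis using x by blast
qed

lemma rho_I_DWplus: "x \<in> I_DWplus r (Suc q) \<Longrightarrow> rho q x \<in> I_DWplus r q"
  by (rule rho_I_DWplus_ideal[OF I_DWplus_ideal cpower_I_DWplus]) auto

text \<open>The target ideal for the previous principle is the part of \<open>I_DW r q\<close> that
  \<open>grade_inv\<close> and \<open>kappa\<close> keep inside \<open>I_DW r q\<close>. It contains
  c^J once the weight exceeds q + 1, by \<open>kappa_bas_I0\<close>.\<close>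

lemma kappa_rho_I_DWplus:
  assumes "x \<in> I_DWplus r (Suc q)"
  shows "kappa r (rho q x) \<in> I_DW r q"
proof -
  have "ideal {x \<in> I_DW r q. grade_inv x \<in> I_DW r q \<and> kappa r x \<in> I_DW r q} (DWt r q)"
    by (rule ideal_stable_part[OF I_DW_ideal])
      (simp_all add: linear_grade_inv linear_kappa grade_inv_DWt kappa_DWt grade_inv_mult kappa_mult)
  moreover have "cpower q j \<in> {x \<in> I_DW r q. grade_inv x \<in> I_DW r q \<and> kappa r x \<in> I_DW r q}"
    if "(\<Sum>i=1..q. i * j i) > Suc q" for j
  proof -
    have "kappa r (cpower q j) \<in> I0 r q"
      unfolding cpower_bas using that set_cmset[of _ _ q j]
      by (intro kappa_bas_I0 cmset_gens) (auto simp: weight_cmset)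
    with that show ?thesis by (simp add: grade_inv_cpower cpower_I0 I0_I_DW)
  qed
  ultimately show ?thesis using rho_I_DWplus_ideal[OF _ _ assms] by blast
qed


section \<open>Induced maps on quotients and cohomology\<close>

text \<open>All representatives of a coset have the same image coset, so the set under
  \<open>the_elem\<close> is a singleton.\<close>

lemma quot_map_coset:
  assumes I: "abelian_subgroup I R" and J: "abelian_subgroup J S" and f: "abelian_group_hom R S f"
    and IJ: "\<And>x. x \<in> I \<Longrightarrow> f x \<in> J" and x: "x \<in> carrier R"
  shows "quot_map S J f (I +>\<^bsub>R\<^esub> x) = J +>\<^bsub>S\<^esub> f x"
proof -
  interpret I: abelian_subgroup I R by fact
  interpret J: abelian_subgroup J S by fact
  interpret f: abelian_group_hom R S f by fact
  have "J +>\<^bsub>S\<^esub> f y = J +>\<^bsub>S\<^esub> f x" if y: "y \<in> I +>\<^bsub>R\<^esub> x" for y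
  proof -
    obtain i where i: "i \<in> I" "y = i \<oplus>\<^bsub>R\<^esub> x"
      using y unfolding a_r_coset_def' by blast
    have "f y = f i \<oplus>\<^bsub>S\<^esub> f x"
      unfolding i(2) by (rule f.hom_add[OF I.a_Hcarr[OF i(1)] x])
    then have "f y \<in> J +>\<^bsub>S\<^esub> f x"
      using IJ[OF i(1)] unfolding a_r_coset_def' by blast
    then show ?thesis
      by (rule J.a_repr_independence'[OF _ f.hom_closed[OF x], symmetric])
  qed
  moreover have "x \<in> I +>\<^bsub>R\<^esub> x" using x by (rule I.a_rcos_self)
  ultimately have "(\<lambda>y. J +>\<^bsub>S\<^esub> f y) ` (I +>\<^bsub>R\<^esub> x) = {J +>\<^bsub>S\<^esub> f x}" by blast
  then show ?thesis by (simp add: quot_map_def)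
qed

lemma ideal_abelian_subgroup: "ideal I R \<Longrightarrow> abelian_subgroup I R"
  by (rule abelian_subgroupI3[OF ideal.axioms(1) ring.is_abelian_group[OF ideal.axioms(2)]])

lemma carrier_Quot: "carrier (R Quot I) = (\<lambda>x. I +>\<^bsub>R\<^esub> x) ` carrier R"
  by (auto simp: FactRing_simps)

text \<open>Only additivity is asserted, because the differentials and \<open>delta\<close> are
  derivations and not multiplicative.\<close>

lemma quot_map_hom:
  assumes I: "ideal I R" and J: "ideal J S" and f: "abelian_group_hom R S f"
    and IJ: "\<And>x. x \<in> I \<Longrightarrow> f x \<in> J"
  shows "abelian_group_hom (R Quot I) (S Quot J) (quot_map S J f)"
proof -
  interpret I: ideal I R by fact
  interpret J: ideal J S by fact
  interpret f: abelian_group_hom R S f by fact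
  interpret RI: ring "R Quot I" by (rule I.quotient_is_ring)
  interpret SJ: ring "S Quot J" by (rule J.quotient_is_ring)
  note coset = quot_map_coset[OF ideal_abelian_subgroup[OF I] ideal_abelian_subgroup[OF J] f IJ]
  have add: "(K +>\<^bsub>T\<^esub> x) \<oplus>\<^bsub>T Quot K\<^esub> (K +>\<^bsub>T\<^esub> y) = K +>\<^bsub>T\<^esub> (x \<oplus>\<^bsub>T\<^esub> y)"
    if "ideal K T" "x \<in> carrier T" "y \<in> carrier T" for K :: "'x set" and T :: "('x, 'y) ring_scheme" and x y
    using ideal.a_rcos_sum[OF that] by (simp add: FactRing_def)
  show ?thesis
    by (intro abelian_group_homI RI.is_abelian_group SJ.is_abelian_group group_hom.intro
        group_hom_axioms.intro RI.add.is_group SJ.add.is_group)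
      (auto simp: hom_def carrier_Quot coset add[OF I] add[OF J])
qed

section \<open>Cohomology classes as cosets of coboundaries\<close>

lemma coboundaries_abelian_subgroup:
  assumes "abelian_group_hom C C d"
  shows "abelian_subgroup (coboundaries C d) C"
proof -
  interpret d: abelian_group_hom C C d by fact
  have "subgroup (d ` carrier C) (add_monoid C)"
    using group_hom.img_is_subgroup[OF d.a_group_hom] by simp
  then show ?thesis
    unfolding coboundaries_def
    by (intro abelian_subgroupI3 additive_subgroupI d.abelian_group_axioms)
qed

lemma quot_map_cohomology:
  assumes F: "abelian_group_hom C D F" and d: "abelian_group_hom C C d"
    and e: "abelian_group_hom D D e"
    and commute: "\<And>x. x \<in> carrier C \<Longrightarrow> F (d x) = e (F x)" and x: "x \<in> carrier C"
  shows "quot_map D (coboundaries D e) F (coboundaries C d +>\<^bsub>C\<^esub> x) = coboundaries D e +>\<^bsub>D\<^esub> F x"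
proof (rule quot_map_coset[OF coboundaries_abelian_subgroup[OF d]
      coboundaries_abelian_subgroup[OF e] F _ x])
  interpret F: abelian_group_hom C D F by fact
  show "F y \<in> coboundaries D e" if "y \<in> coboundaries C d" for y
    using that commute by (auto simp: coboundaries_def)
qed

text \<open>Cosets depend only on the addition, which restricting the carrier to cocycles leaves
  alone; classes may therefore be handled as cosets in the whole complex.\<close>

lemma carrier_cohomology:
  "carrier (cohomology C d) = (\<lambda>x. coboundaries C d +>\<^bsub>C\<^esub> x) ` cocycles C d"
  by (simp add: cohomology_def carrier_Quot a_r_coset_def r_coset_def)

lemma linear_DWt_hom:
  assumes "linear f" "\<And>x. x \<in> carrier (DWt r q) \<Longrightarrow> f x \<in> carrier (DWt r q')"
  shows "abelian_group_hom (DWt r q) (DWt r q') f"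
proof -
  interpret R: ring "DWt r q" by (rule DWt_ring)
  interpret S: ring "DWt r q'" by (rule DWt_ring)
  show ?thesis
    by (intro abelian_group_homI R.is_abelian_group S.is_abelian_group group_hom.intro
        group_hom_axioms.intro R.add.is_group S.add.is_group)
      (use assms in \<open>auto simp: hom_def linear_add\<close>)
qed

lemma DWt_quot_eq_zero_iff:
  assumes "ideal I (DWt r q)" "x \<in> carrier (DWt r q)"
  shows "I +>\<^bsub>DWt r q\<^esub> x = I \<longleftrightarrow> x \<in> I"
  using ideal.rcos_const_imp_mem[OF assms]
    abelian_subgroup.a_rcos_const[OF ideal_abelian_subgroup[OF assms(1)], of x] by auto

theorem theorem8p17:
  fixes q :: nat and r :: enat
  assumes "q \<ge> 1"
  shows "\<forall>\<gamma> \<in> rho' r q ` carrier (H_DWplus r (q + 1)). formally_rigid r q \<gamma>"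
  unfolding Suc_eq_plus1[symmetric]
proof
  note dd_hom = linear_DWt_hom[OF dd_signed_derivation(1) dd_DWt]
  note rho_hom' = linear_DWt_hom[OF rho_hom(1) rho_DWt]
  note id_hom = linear_DWt_hom[OF linear_ident]
  note delta_hom = linear_DWt_hom[OF delta_derivation(1) delta_DWt]
  note sub = ideal_abelian_subgroup[OF I_DW_ideal] ideal_abelian_subgroup[OF I_DWplus_ideal]
  \<comment> \<open>Every induced map is first computed on cosets of representatives, which moves
    all later calculations into the free algebra.\<close>
  have dP: "d_DWplus r n (I_DWplus r n +>\<^bsub>DWt r n\<^esub> x) = I_DWplus r n +>\<^bsub>DWt r n\<^esub> dd x"
    if "x \<in> carrier (DWt r n)" for n x
    unfolding d_DWplus_def by (rule quot_map_coset[OF sub(2) sub(2) dd_hom dd_I_DWplus that])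
  have dW: "d_DW r n (I_DW r n +>\<^bsub>DWt r n\<^esub> x) = I_DW r n +>\<^bsub>DWt r n\<^esub> dd x"
    if "x \<in> carrier (DWt r n)" for n x
    unfolding d_DW_def by (rule quot_map_coset[OF sub(1) sub(1) dd_hom dd_I_DW that])
  have dP_hom: "abelian_group_hom (DWplus r n) (DWplus r n) (d_DWplus r n)" for n
    unfolding DWplus_def d_DWplus_def
    by (rule quot_map_hom[OF I_DWplus_ideal I_DWplus_ideal dd_hom dd_I_DWplus])
  have dW_hom: "abelian_group_hom (DW r n) (DW r n) (d_DW r n)" for n
    unfolding DW_def d_DW_def by (rule quot_map_hom[OF I_DW_ideal I_DW_ideal dd_hom dd_I_DW])

  let ?rho = "quot_map (DWt r q) (I_DWplus r q) (rho q)"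
  let ?nat = "quot_map (DWt r q) (I_DW r q) (\<lambda>x. x)"
  let ?del = "quot_map (DWt r q) (I_DW r q) (delta r)"
  have rho: "?rho (I_DWplus r (Suc q) +>\<^bsub>DWt r (Suc q)\<^esub> x) = I_DWplus r q +>\<^bsub>DWt r q\<^esub> rho q x"
    if "x \<in> carrier (DWt r (Suc q))" for x
    by (rule quot_map_coset[OF sub(2) sub(2) rho_hom' rho_I_DWplus that])
  have nat: "?nat (I_DWplus r q +>\<^bsub>DWt r q\<^esub> x) = I_DW r q +>\<^bsub>DWt r q\<^esub> x"
    if "x \<in> carrier (DWt r q)" for x
    by (rule quot_map_coset[OF sub(2) sub(1) id_hom _ that]) (use I_DWplus_subset in auto)
  have del: "?del (I_DW r q +>\<^bsub>DWt r q\<^esub> x) = I_DW r q +>\<^bsub>DWt r q\<^esub> delta r x"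
    if "x \<in> carrier (DWt r q)" for x
    by (rule quot_map_coset[OF sub(1) sub(1) delta_hom delta_I_DW that])
  have carr: "I_DWplus r n +>\<^bsub>DWt r n\<^esub> x \<in> carrier (DWplus r n)"
      "I_DW r n +>\<^bsub>DWt r n\<^esub> x \<in> carrier (DW r n)" if "x \<in> carrier (DWt r n)" for n x
    using that by (simp_all add: DWplus_def DW_def carrier_Quot)

  \<comment> \<open>The maps on cohomology follow from those on the complexes once these commute
    with the differentials.\<close>
  have rho_H: "rho_H r q (coboundaries (DWplus r (Suc q)) (d_DWplus r (Suc q)) +>\<^bsub>DWplus r (Suc q)\<^esub> X)
      = coboundaries (DWplus r q) (d_DWplus r q) +>\<^bsub>DWplus r q\<^esub> ?rho X"
    if "X \<in> carrier (DWplus r (Suc q))" for X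
    unfolding rho_H_def
  proof (rule quot_map_cohomology[OF _ dP_hom dP_hom _ that])
    show "abelian_group_hom (DWplus r (Suc q)) (DWplus r q) ?rho"
      unfolding DWplus_def
      by (rule quot_map_hom[OF I_DWplus_ideal I_DWplus_ideal rho_hom' rho_I_DWplus])
    show "?rho (d_DWplus r (Suc q) Y) = d_DWplus r q (?rho Y)" if "Y \<in> carrier (DWplus r (Suc q))" for Y
      using that by (auto simp: DWplus_def carrier_Quot dP rho dd_DWt rho_DWt rho_dd)
  qed
  have nat_H: "nat_H r q (coboundaries (DWplus r q) (d_DWplus r q) +>\<^bsub>DWplus r q\<^esub> X)
      = coboundaries (DW r q) (d_DW r q) +>\<^bsub>DW r q\<^esub> ?nat X"
    if "X \<in> carrier (DWplus r q)" for X
    unfolding nat_H_def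
  proof (rule quot_map_cohomology[OF _ dP_hom dW_hom _ that])
    show "abelian_group_hom (DWplus r q) (DW r q) ?nat"
      unfolding DWplus_def DW_def
      by (rule quot_map_hom[OF I_DWplus_ideal I_DW_ideal id_hom]) (use I_DWplus_subset in auto)
    show "?nat (d_DWplus r q Y) = d_DW r q (?nat Y)" if "Y \<in> carrier (DWplus r q)" for Y
      using that by (auto simp: DWplus_def carrier_Quot dP dW nat dd_DWt)
  qed
  have delta_H: "delta_H r q (coboundaries (DW r q) (d_DW r q) +>\<^bsub>DW r q\<^esub> X)
      = coboundaries (DW r q) (d_DW r q) +>\<^bsub>DW r q\<^esub> ?del X"
    if "X \<in> carrier (DW r q)" for X
    unfolding delta_H_def
  proof (rule quot_map_cohomology[OF _ dW_hom dW_hom _ that])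
    show "abelian_group_hom (DW r q) (DW r q) ?del"
      unfolding DW_def by (rule quot_map_hom[OF I_DW_ideal I_DW_ideal delta_hom delta_I_DW])
    show "?del (d_DW r q Y) = d_DW r q (?del Y)" if "Y \<in> carrier (DW r q)" for Y
      using that by (auto simp: DW_def carrier_Quot dW del dd_DWt delta_DWt dd_delta)
  qed

  fix \<gamma> assume "\<gamma> \<in> rho' r q ` carrier (H_DWplus r (Suc q))"
  then obtain X where X: "X \<in> cocycles (DWplus r (Suc q)) (d_DWplus r (Suc q))"
    and \<gamma>: "\<gamma> = rho' r q (coboundaries (DWplus r (Suc q)) (d_DWplus r (Suc q)) +>\<^bsub>DWplus r (Suc q)\<^esub> X)"
    by (auto simp: H_DWplus_def carrier_cohomology)
  then obtain x where x: "x \<in> carrier (DWt r (Suc q))"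
    and X_eq: "X = I_DWplus r (Suc q) +>\<^bsub>DWt r (Suc q)\<^esub> x"
    by (auto simp: cocycles_def DWplus_def carrier_Quot)
  \<comment> \<open>The cocycle condition holds modulo the ideal for q + 1; this is the source of
    the extra unit of weight.\<close>
  have dx: "dd x \<in> I_DWplus r (Suc q)"
    using X dP[OF x] DWt_quot_eq_zero_iff[OF I_DWplus_ideal dd_DWt[OF x]]
    by (simp add: cocycles_def X_eq DWplus_def FactRing_def)
  define y where "y = rho q x"
  have y: "y \<in> carrier (DWt r q)" using rho_DWt[OF x] by (simp add: y_def)
  let ?B = "coboundaries (DW r q) (d_DW r q)"
  have \<gamma>_eq: "\<gamma> = ?B +>\<^bsub>DW r q\<^esub> (I_DW r q +>\<^bsub>DWt r q\<^esub> y)"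
    unfolding \<gamma> rho'_def comp_def X_eq y_def
    using x rho_DWt[OF x] by (simp only: rho_H nat_H carr rho nat)

  have "dd y \<in> I_DW r q"
    using rho_I_DWplus[OF dx] I_DWplus_subset by (auto simp: y_def rho_dd)
  then have "I_DW r q +>\<^bsub>DWt r q\<^esub> y \<in> cocycles (DW r q) (d_DW r q)"
    using y DWt_quot_eq_zero_iff[OF I_DW_ideal dd_DWt[OF y]]
    by (simp add: cocycles_def carr dW) (simp add: DW_def FactRing_def)
  then have "\<gamma> \<in> carrier (H_DW r q)"
    by (simp add: \<gamma>_eq H_DW_def carrier_cohomology)

  moreover have "I_DW r q +>\<^bsub>DWt r q\<^esub> delta r y \<in> ?B"
  proof -
    interpret I: abelian_subgroup "I_DW r q" "DWt r q" by (rule sub(1))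
    \<comment> \<open>Since \<open>rho q\<close> commutes with \<open>dd\<close>,
      \<open>dd y\<close> is the restriction of \<open>dd x\<close>.\<close>
    have "kappa r (dd y) \<in> I_DW r q"
      using kappa_rho_I_DWplus[OF dx] by (simp add: y_def rho_dd)
    \<comment> \<open>In the homotopy formula the term \<open>kappa r (dd y)\<close> is absorbed by
      the ideal, leaving the differential of the coset of \<open>kappa r y\<close>.\<close>
    then have "delta r y \<in> I_DW r q +>\<^bsub>DWt r q\<^esub> dd (kappa r y)"
      by (auto simp: a_r_coset_def' delta_homotopy add.commute)
    then have "I_DW r q +>\<^bsub>DWt r q\<^esub> delta r y = d_DW r q (I_DW r q +>\<^bsub>DWt r q\<^esub> kappa r y)"
      using I.a_repr_independence'[of "delta r y" "dd (kappa r y)"] y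
      by (simp add: dW kappa_DWt dd_DWt)
    then show ?thesis
      using y by (auto simp: coboundaries_def carr kappa_DWt)
  qed
  \<comment> \<open>Translating \<open>?B\<close> by one of its own elements gives \<open>?B\<close>
    again, the zero of the cohomology.\<close>
  then have "delta_H r q \<gamma> = \<zero>\<^bsub>H_DW r q\<^esub>"
    using y abelian_subgroup.a_rcos_const[OF coboundaries_abelian_subgroup[OF dW_hom]]
    by (simp add: \<gamma>_eq delta_H carr del) (simp add: H_DW_def cohomology_def FactRing_def)
  ultimately show "formally_rigid r q \<gamma>"
    by (simp add: formally_rigid_def)
qed

end
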